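(* Assume $-\frac{6}{5}\beta<\gamma<0$. Let $k\in\mathbb{N}$ and $V^0\in\mathcal{A}^g_k$ with $G_{\mathrm{CH}}(V^0)<\infty$. Let $V$ be a Generalized Minimizing Movement restricted to $\mathcal{A}^g$ starting from $V^0$. Then $V(t)\in\mathcal{A}^g_k$ for all $t\ge0$, i.e., the flow conserves multiplicity.
   Context: Fix $m_0>0$, $\beta>0$, $\gamma,H_0\in\mathbb{R}$, $p\in[1,\infty)$, a genus $g\in\mathbb{N}_0$, $L>0$, and a smooth connected closed (compact, without boundary) surface $\Sigma^g$ embedded in $\mathbb{R}^3$ with genus $g$. $\mathbb{N}=\{1,2,\dots\}$. For a closed connected embedded $C^{1,1}$ surface $M\subset\mathbb{R}^3$ with outer unit normal $\nu:M\to\mathbb{S}^2$ and $k\in\mathbb{N}$, let $V[M,\nu,k,0]$ be the oriented varifold, i.e. the positive Radon measure on $\mathbb{R}^3\times\mathbb{S}^2$, given by $\psi\mapsto k\int_M\psi(x,\nu(x))\,d\mathcal{H}^2(x)$. Its mass is $\mu_V=k\,\mathcal{H}^2\llcorner M$. $\mathcal{A}^g_k$ is the set of $V=V[M,\nu,k,0]$ with total mass $k\,\mathcal{H}^2(M)=m_0$, where $M=\psi(\Sigma^g)$ for an embedding $\psi\in C^{1,1}(\Sigma^g;\mathbb{R}^3)$ (injective, $\nabla\psi$ of rank two) with $\|\psi\|_{C^{1,1}(\Sigma^g)}\le L$ and $\nu$ is the outer unit normal to $M$. Here $\|\psi\|_{C^{1,1}(\Sigma)}:=\sup_{x\in\Sigma}\big(|\psi(x)|+|\nabla\psi(x)|+\sup_{x'\ne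 x}\frac{|\nabla\psi(x)-\nabla\psi(x')|}{|x-x'|}\big)$. The surfaces $M$ in these classes are of uniform $C^{1,1}$ regularity: they satisfy a uniform ball condition, i.e. there is $r>0$ depending only on the fixed data (not on $M$ or $k$) such that for every $x\in M$ the open balls $B_r(x+r\nu(x))$ and $B_r(x-r\nu(x))$ do not meet $M$. (Such $V$ are automatically oriented curvature varifolds without boundary and induce currents without boundary.) Set $\mathcal{A}^g:=\bigcup_{k\in\mathbb{N}}\mathcal{A}^g_k$. For $V=V[M,\nu,k,0]\in\mathcal{A}^g_k$ the Canham-Helfrich energy is $G_{\mathrm{CH}}(V)=k\int_M\big(\frac{\beta}{2}(H-H_0)^2+\gamma K\big)\,d\mathcal{H}^2$, with $K$ the Gauss curvature and $H$ the mean curvature (sum of principal curvatures) with sign $H=-\mathrm{div}_M\nu$ (so $H=-2/R$ on the sphere of radius $R$ with outer normal), both defined a.e. $W_p(V,\tilde V)=\big(\min_\lambda\int d^p\,d\lambda\big)^{1/p}$ is the $p$-Wasserstein distance, the minimum being over positive Radon measures $\lambda$ on $(\mathbb{R}^3\times\mathbb{S}^2)^2$ with marginals $V,\tilde V$, and $d((x,\nu),(\tilde x,\tilde\nu))=|x-\tilde x|+|\nu-\tilde\nu|$. GMM restricted to $\mathcal{A}^g$: for $\tau>0$, discrete minimizers are $V^0_\tau:=V^0$, $V^n_\tau\in\mathrm{argmin}_{V\in\mathcal{A}^g}\{G_{\mathrm{CH}}(V)+\frac1{2\tau}W_p^2(V,V^{n-1}_\tau)\}$, $n\in\mathbb{N}$;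 the interpolant is $\overline V_\tau(0)=V^0$, $\overline V_\tau(t)=V^n_\tau$ for $t\in((n-1)\tau,n\tau]$. A curve $V:[0,\infty)\to\mathcal{A}^g$ is a Generalized Minimizing Movement restricted to $\mathcal{A}^g$ starting from $V^0$ if there exist a sequence $\tau_m\to0$ and corresponding interpolants of discrete minimizers with $\overline V_{\tau_m}(t)\to V(t)$ in $W_p$ for all $t\ge0$.
   Formalization: The uniform ball condition with a fixed r>0 (arbitrary, common to all M and k) is made part of the definition of A^g_k; it does not follow from the C^{1,1} norm bound, since shrinking the surface while raising k stays in the class but violates any fixed r. *)

theory Defs
  imports "HOL-Analysis.Analysis"
begin

type_synonym R3 = "real^3"

section \<open>Surfaces in space\<close>

primrec Ck_on :: "nat \<Rightarrow> R3 set \<Rightarrow> (R3 \<Rightarrow> real) \<Rightarrow> bool" where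
  "Ck_on 0 U f \<longleftrightarrow> continuous_on U f"
| "Ck_on (Suc k) U f \<longleftrightarrow>
     (\<exists>f'. (\<forall>x\<in>U. (f has_derivative f' x) (at x)) \<and> (\<forall>v. Ck_on k U (\<lambda>x. f' x v)))"

definition smooth_on :: "R3 set \<Rightarrow> (R3 \<Rightarrow> real) \<Rightarrow> bool" where
  "smooth_on U f \<longleftrightarrow> (\<forall>k. Ck_on k U f)"

text \<open>Embedded hypersurfaces are described locally as regular level sets; without boundary is
  implicit in this.\<close>

definition smooth_closed_surface :: "R3 set \<Rightarrow> bool" where
  "smooth_closed_surface S \<longleftrightarrow> S \<noteq> {} \<and> compact S \<and> connected S \<and>
     (\<forall>x\<in>S. \<exists>U F. open U \<and> x \<in> U \<and> smooth_on U F \<and>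
        (\<forall>y\<in>U. frechet_derivative F (at y) \<noteq> (\<lambda>v. 0)) \<and>
        S \<inter> U = {y\<in>U. F y = 0})"

text \<open>The genus is the maximal number of pairwise disjoint simple closed curves on the surface
  whose union does not disconnect it.\<close>

definition nonseparating_curves :: "R3 set \<Rightarrow> R3 set set \<Rightarrow> bool" where
  "nonseparating_curves S \<C> \<longleftrightarrow> finite \<C> \<and> pairwise disjnt \<C> \<and>
     (\<forall>C\<in>\<C>. C \<subseteq> S \<and> (\<exists>c. simple_path c \<and> pathfinish c = pathstart c \<and> C = path_image c)) \<and>
     connected (S - \<Union>\<C>)"

definition has_genus :: "R3 set \<Rightarrow> nat \<Rightarrow> bool" where
  "has_genus S g \<longleftrightarrow> (\<exists>\<C>. nonseparating_curves S \<C> \<and> card \<C> = g) \<and>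
     (\<forall>\<C>. nonseparating_curves S \<C> \<longrightarrow> card \<C> \<le> g)"

definition tangent_space :: "R3 set \<Rightarrow> R3 \<Rightarrow> R3 set" where
  "tangent_space M x = {v. \<exists>c :: real \<Rightarrow> R3. c 0 = x \<and> (\<forall>\<^sub>F t in nhds 0. c t \<in> M) \<and>
     (c has_vector_derivative v) (at 0)}"

text \<open>The tangential gradient is the matrix of the differential, extended by zero to the
  normal direction, so that its values at different points can be compared.\<close>

definition tangential_gradient :: "R3 set \<Rightarrow> (R3 \<Rightarrow> R3) \<Rightarrow> R3 \<Rightarrow> real^3^3" where
  "tangential_gradient S \<psi> x = (THE D. (\<psi> has_derivative (\<lambda>v. D *v v)) (at x within S) \<and>
     (\<forall>n. (\<forall>v\<in>tangent_space S x. n \<bullet> v = 0) \<longrightarrow> D *v n = 0))"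

text \<open>The norm on matrices is the Frobenius norm.\<close>

definition C11_norm :: "R3 set \<Rightarrow> (R3 \<Rightarrow> R3) \<Rightarrow> ennreal" where
  "C11_norm S \<psi> = (SUP x\<in>S. ennreal (norm (\<psi> x)) + ennreal (norm (tangential_gradient S \<psi> x)) +
     (SUP x'\<in>S - {x}. ennreal (norm (tangential_gradient S \<psi> x - tangential_gradient S \<psi> x')
        / norm (x - x'))))"

definition C11_embedding :: "R3 set \<Rightarrow> (R3 \<Rightarrow> R3) \<Rightarrow> bool" where
  "C11_embedding S \<psi> \<longleftrightarrow> \<psi> differentiable_on S \<and> C11_norm S \<psi> < \<infinity> \<and> inj_on \<psi> S \<and>
     (\<forall>x\<in>S. rank (tangential_gradient S \<psi> x) = 2)"

definition C11_closed_surface :: "R3 set \<Rightarrow> bool" where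
  "C11_closed_surface M \<longleftrightarrow>
     (\<exists>S \<psi>. smooth_closed_surface S \<and> C11_embedding S \<psi> \<and> M = \<psi> ` S)"

definition outer_unit_normal :: "R3 set \<Rightarrow> (R3 \<Rightarrow> R3) \<Rightarrow> bool" where
  "outer_unit_normal M \<nu> \<longleftrightarrow> (\<forall>x\<in>M. norm (\<nu> x) = 1 \<and> (\<forall>v\<in>tangent_space M x. \<nu> x \<bullet> v = 0) \<and>
     (\<exists>\<epsilon>>0. \<forall>t\<in>{0<..<\<epsilon>}. x + t *\<^sub>R \<nu> x \<in> outside M \<and> x - t *\<^sub>R \<nu> x \<in> inside M))"

definition uniform_ball_condition :: "real \<Rightarrow> R3 set \<Rightarrow> (R3 \<Rightarrow> R3) \<Rightarrow> bool" where
  "uniform_ball_condition r M \<nu> \<longleftrightarrow>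
     (\<forall>x\<in>M. ball (x + r *\<^sub>R \<nu> x) r \<inter> M = {} \<and> ball (x - r *\<^sub>R \<nu> x) r \<inter> M = {})"

section \<open>Curvatures\<close>

text \<open>The derivative within \<open>M\<close> is only determined on the tangent plane, i.e. orthogonally to
  \<open>\<nu> x\<close>, whence the projection. Points of non-differentiability form a null set on a \<open>C\<^sup>1\<^sup>,\<^sup>1\<close> surface; the value
  there is set to zero.\<close>

definition weingarten :: "R3 set \<Rightarrow> (R3 \<Rightarrow> R3) \<Rightarrow> R3 \<Rightarrow> R3 \<Rightarrow> R3" where
  "weingarten M \<nu> x v = (if \<nu> differentiable (at x within M)
     then frechet_derivative \<nu> (at x within M) (v - (v \<bullet> \<nu> x) *\<^sub>R \<nu> x) else 0)"

definition mean_curvature :: "R3 set \<Rightarrow> (R3 \<Rightarrow> R3) \<Rightarrow> R3 \<Rightarrow> real" where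
  "mean_curvature M \<nu> x = - trace (matrix (weingarten M \<nu> x))"

text \<open>The Weingarten map preserves the tangent plane; extending it by the identity in the normal
  direction does not change its determinant.\<close>

definition gauss_curvature :: "R3 set \<Rightarrow> (R3 \<Rightarrow> R3) \<Rightarrow> R3 \<Rightarrow> real" where
  "gauss_curvature M \<nu> x = det (matrix (\<lambda>v. weingarten M \<nu> x v + (v \<bullet> \<nu> x) *\<^sub>R \<nu> x))"

section \<open>Hausdorff measure and varifolds\<close>

text \<open>The outer measure is a metric outer measure, so that by the criterion of Caratheodory its
  restriction to the Borel sets is a measure.\<close>

definition hausdorff2_pre :: "real \<Rightarrow> R3 set \<Rightarrow> ennreal" where
  "hausdorff2_pre \<delta> A =
     (INF C\<in>{C :: nat \<Rightarrow> R3 set. A \<subseteq> (\<Union>i. C i) \<and> (\<forall>i. bounded (C i) \<and> diameter (C i) \<le> \<delta>)}.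
        \<Sum>i. ennreal (pi * (diameter (C i) / 2)\<^sup>2))"

definition hausdorff2_outer :: "R3 set \<Rightarrow> ennreal" where
  "hausdorff2_outer A = (SUP \<delta>\<in>{0<..}. hausdorff2_pre \<delta> A)"

definition hausdorff2 :: "R3 measure" where
  "hausdorff2 = measure_of UNIV (sets borel) hausdorff2_outer"

text \<open>Measures on \<open>\<real>\<^sup>3 \<times> \<S>\<^sup>2\<close> are represented by Borel measures on \<open>\<real>\<^sup>3 \<times> \<real>\<^sup>3\<close>
  concentrated on that set.\<close>

definition varifold :: "R3 set \<Rightarrow> (R3 \<Rightarrow> R3) \<Rightarrow> nat \<Rightarrow> (R3 \<times> R3) measure" where
  "varifold M \<nu> k =
     scale_measure (of_nat k) (distr (restrict_space hausdorff2 M) borel (\<lambda>x. (x, \<nu> x)))"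

text \<open>The radius \<open>r\<close> in the uniform ball condition is part of the data, common to all surfaces
  and all multiplicities. The condition has to be imposed: the bound on \<open>C11_norm\<close> alone does not
  imply it, since it is stable under shrinking \<open>\<psi>\<close>.\<close>

definition admissible :: "R3 set \<Rightarrow> real \<Rightarrow> real \<Rightarrow> real \<Rightarrow> nat \<Rightarrow> (R3 \<times> R3) measure set" where
  "admissible S L r m\<^sub>0 k = {V. \<exists>\<psi> \<nu>. C11_embedding S \<psi> \<and> C11_norm S \<psi> \<le> ennreal L \<and>
     outer_unit_normal (\<psi> ` S) \<nu> \<and> uniform_ball_condition r (\<psi> ` S) \<nu> \<and>
     of_nat k * emeasure hausdorff2 (\<psi> ` S) = ennreal m\<^sub>0 \<and> V = varifold (\<psi> ` S) \<nu> k}"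

definition admissible_all :: "R3 set \<Rightarrow> real \<Rightarrow> real \<Rightarrow> real \<Rightarrow> (R3 \<times> R3) measure set" where
  "admissible_all S L r m\<^sub>0 = (\<Union>k\<in>{1..}. admissible S L r m\<^sub>0 k)"

section \<open>Canham--Helfrich energy\<close>

definition CH_density :: "real \<Rightarrow> real \<Rightarrow> real \<Rightarrow> R3 set \<Rightarrow> (R3 \<Rightarrow> R3) \<Rightarrow> R3 \<Rightarrow> real" where
  "CH_density \<beta> \<gamma> H\<^sub>0 M \<nu> x =
     \<beta> / 2 * (mean_curvature M \<nu> x - H\<^sub>0)\<^sup>2 + \<gamma> * gauss_curvature M \<nu> x"

text \<open>The measure \<open>V\<close> determines \<open>M\<close>, \<open>k\<close> and the values of \<open>\<nu>\<close> on \<open>M\<close>, hence the energy.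
  The energy density is bounded under a uniform ball condition, so the value \<open>\<infinity>\<close> only
  occurs outside the classes \<open>admissible\<close> with \<open>r > 0\<close>.\<close>

definition CH_energy :: "real \<Rightarrow> real \<Rightarrow> real \<Rightarrow> (R3 \<times> R3) measure \<Rightarrow> ereal" where
  "CH_energy \<beta> \<gamma> H\<^sub>0 V = (THE E. \<exists>M \<nu> k. C11_closed_surface M \<and> outer_unit_normal M \<nu> \<and> k \<ge> 1 \<and>
     V = varifold M \<nu> k \<and>
     E = (if set_integrable hausdorff2 M (CH_density \<beta> \<gamma> H\<^sub>0 M \<nu>)
          then ereal (real k * (LINT x:M|hausdorff2. CH_density \<beta> \<gamma> H\<^sub>0 M \<nu> x)) else \<infinity>))"

section \<open>Wasserstein distance and minimizing movements\<close>

definition phase_dist :: "R3 \<times> R3 \<Rightarrow> R3 \<times> R3 \<Rightarrow> real" where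
  "phase_dist z w = norm (fst z - fst w) + norm (snd z - snd w)"

definition couplings ::
  "(R3 \<times> R3) measure \<Rightarrow> (R3 \<times> R3) measure \<Rightarrow> ((R3 \<times> R3) \<times> (R3 \<times> R3)) measure set" where
  "couplings V W = {\<Lambda>. sets \<Lambda> = sets borel \<and> distr \<Lambda> borel fst = V \<and> distr \<Lambda> borel snd = W}"

text \<open>For finite measures of equal mass the infimum is attained.\<close>

definition transport_cost :: "real \<Rightarrow> (R3 \<times> R3) measure \<Rightarrow> (R3 \<times> R3) measure \<Rightarrow> ennreal" where
  "transport_cost p V W =
     (INF \<Lambda>\<in>couplings V W. \<integral>\<^sup>+ zw. ennreal (phase_dist (fst zw) (snd zw) powr p) \<partial>\<Lambda>)"

definition wasserstein :: "real \<Rightarrow> (R3 \<times> R3) measure \<Rightarrow> (R3 \<times> R3) measure \<Rightarrow> ereal" where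
  "wasserstein p V W = (if transport_cost p V W = \<infinity> then \<infinity>
     else ereal (enn2real (transport_cost p V W) powr (1 / p)))"

text \<open>The following notions make sense for an arbitrary energy \<open>G\<close> and class \<open>A\<close>.\<close>

definition discrete_minimizers ::
  "real \<Rightarrow> ((R3 \<times> R3) measure \<Rightarrow> ereal) \<Rightarrow> (R3 \<times> R3) measure set \<Rightarrow> real \<Rightarrow> (R3 \<times> R3) measure \<Rightarrow>
   (nat \<Rightarrow> (R3 \<times> R3) measure) \<Rightarrow> bool" where
  "discrete_minimizers p G A \<tau> V\<^sub>0 X \<longleftrightarrow> X 0 = V\<^sub>0 \<and>
     (\<forall>n. is_arg_min (\<lambda>V. G V + ereal (1 / (2 * \<tau>)) * (wasserstein p V (X n))\<^sup>2)
        (\<lambda>V. V \<in> A) (X (Suc n)))"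

text \<open>Equals \<open>X 0\<close> at \<open>t = 0\<close> and \<open>X n\<close> for \<open>t \<in> ((n - 1) \<tau>, n \<tau>]\<close>.\<close>

definition interpolant :: "real \<Rightarrow> (nat \<Rightarrow> 'a) \<Rightarrow> real \<Rightarrow> 'a" where
  "interpolant \<tau> X t = X (nat \<lceil>t / \<tau>\<rceil>)"

definition is_GMM ::
  "real \<Rightarrow> ((R3 \<times> R3) measure \<Rightarrow> ereal) \<Rightarrow> (R3 \<times> R3) measure set \<Rightarrow> (R3 \<times> R3) measure \<Rightarrow>
   (real \<Rightarrow> (R3 \<times> R3) measure) \<Rightarrow> bool" where
  "is_GMM p G A V\<^sub>0 V \<longleftrightarrow> (\<forall>t\<ge>0. V t \<in> A) \<and>
     (\<exists>\<tau> X. (\<forall>m :: nat. \<tau> m > 0) \<and> \<tau> \<longlonglongrightarrow> 0 \<and>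
        (\<forall>m. discrete_minimizers p G A (\<tau> m) V\<^sub>0 (X m)) \<and>
        (\<forall>t\<ge>0. (\<lambda>m. wasserstein p (interpolant (\<tau> m) (X m) t) (V t)) \<longlonglongrightarrow> 0))"

end

theory Submission
  imports Defs
begin

text \<open>
  The multiplicity cannot change because varifolds of different multiplicity are uniformly far
  apart in the Wasserstein distance, while a discrete minimizer is close to its predecessor when
  the time step is small.

  The separation is a statement about areas. Let \<open>M\<close> and \<open>M'\<close> both satisfy the ball condition
  with radius \<open>r\<close> and carry the same mass with multiplicities \<open>k\<close> and \<open>k'\<close>. Every ball around a
  point of such a surface contains a definite amount of area, so a cheap transport plan forces
  every point of \<open>M'\<close>, together with its normal, to be near a point of \<open>M\<close> with its normal
  (\<open>transport_near\<close>). Then the nearest point map from \<open>M'\<close> to \<open>M\<close> shrinks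
  distances locally at most by a factor \<open>1 / (1 + 4 s)\<close> with small \<open>s\<close>, whence the area of
  \<open>M'\<close> is at most \<open>(1 + 4 s)\<^sup>2\<close> times that of \<open>M\<close> (\<open>area_comparison\<close>). As \<open>k \<H>\<^sup>2(M) = k' \<H>\<^sup>2(M')\<close>,
  this bounds \<open>k / k'\<close> by a number close to one, and by symmetry also \<open>k' / k\<close>. Both multiplicities are
  bounded in terms of the mass and \<open>r\<close>, because the areas are bounded below; two such integers
  with quotient close to one are equal (\<open>multiplicity_separation\<close>).

  For the time steps, comparing a minimizer with its predecessor bounds the squared distance by
  \<open>2 \<tau>\<close> times the energy drop. The energy of the initial datum is finite, and the energy is
  bounded below on the whole class: the ball condition makes \<open>\<nu>\<close> Lipschitz with constant \<open>1 / r\<close>,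
  so both curvatures are bounded (\<open>CH_energy_varifold_ge\<close>). Hence all distances between
  consecutive minimizers fall below the separation constant as \<open>\<tau> \<rightarrow> 0\<close>. The limit inherits
  the multiplicity for the same reason.

  All geometric input comes from the two tangent balls, of which one lies inside and the other
  outside the surface: a segment from the inner to the outer ball must cross \<open>M\<close>
  (\<open>inside_outside_crossing\<close>). This replaces local parametrizations: it yields the tangent plane,
  the lower area bounds and the uniqueness of the normal. Areas are compared by
  covering arguments only, without an area formula.
\<close>

section \<open>The two-dimensional Hausdorff measure\<close>

lemma hausdorff2_pre_mono: "A \<subseteq> B \<Longrightarrow> hausdorff2_pre \<delta> A \<le> hausdorff2_pre \<delta> B"
  unfolding hausdorff2_pre_def by (rule INF_superset_mono) auto

lemma hausdorff2_pre_antimono: "\<delta> \<le> \<delta>' \<Longrightarrow> hausdorff2_pre \<delta>' A \<le> hausdorff2_pre \<delta> A"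
  unfolding hausdorff2_pre_def by (rule INF_superset_mono) (auto intro: order_trans)

lemma hausdorff2_pre_empty: "\<delta> > 0 \<Longrightarrow> hausdorff2_pre \<delta> {} = 0"
  unfolding hausdorff2_pre_def
  by (intro antisym INF_lower2[of "\<lambda>_. {}"]) (auto simp: less_imp_le)

lemma hausdorff2_pre_subadditive:
  "hausdorff2_pre \<delta> (\<Union>i. A i) \<le> (\<Sum>i. hausdorff2_pre \<delta> (A i))"
proof (rule ennreal_le_epsilon)
  fix e :: real assume "0 < e" and fin: "(\<Sum>i. hausdorff2_pre \<delta> (A i)) < top"
  let ?w = "\<lambda>D :: R3 set. ennreal (pi * (diameter D / 2)\<^sup>2)"
  have "\<exists>C :: nat \<Rightarrow> R3 set. A i \<subseteq> (\<Union>j. C j) \<and> (\<forall>j. bounded (C j) \<and> diameter (C j) \<le> \<delta>) \<and>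
      (\<Sum>j. ?w (C j)) \<le> hausdorff2_pre \<delta> (A i) + ennreal (e * (1/2) ^ Suc i)" for i
  proof -
    have "hausdorff2_pre \<delta> (A i) < top"
      using fin by (metis ennreal_suminf_lessD)
    then have "hausdorff2_pre \<delta> (A i) < hausdorff2_pre \<delta> (A i) + ennreal (e * (1/2) ^ Suc i)"
      using \<open>0 < e\<close> by (simp add: ennreal_zero_less_mult_iff ennreal_add_left_cancel_less[of _ 0, simplified])
    then show ?thesis
      unfolding hausdorff2_pre_def[of \<delta> "A i"] INF_less_iff by (auto intro: less_imp_le)
  qed
  then obtain C :: "nat \<Rightarrow> nat \<Rightarrow> R3 set" where C: "\<And>i. A i \<subseteq> (\<Union>j. C i j)"
      "\<And>i j. bounded (C i j) \<and> diameter (C i j) \<le> \<delta>"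
      "\<And>i. (\<Sum>j. ?w (C i j)) \<le> hausdorff2_pre \<delta> (A i) + ennreal (e * (1/2) ^ Suc i)"
    by metis
  have "(\<Union>i. A i) \<subseteq> (\<Union>n. case_prod C (prod_decode n))"
  proof
    fix x assume "x \<in> (\<Union>i. A i)"
    then obtain i j where "x \<in> C i j" using C(1) by blast
    then show "x \<in> (\<Union>n. case_prod C (prod_decode n))"
      by (intro UN_I[of "prod_encode (i, j)"]) auto
  qed
  then have "hausdorff2_pre \<delta> (\<Union>i. A i) \<le> (\<Sum>n. ?w (case_prod C (prod_decode n)))"
    unfolding hausdorff2_pre_def
    by (intro INF_lower) (use C(2) in \<open>simp add: case_prod_beta\<close>)
  also have "\<dots> = (\<Sum>i. \<Sum>j. ?w (C i j))"
    by (rule suminf_ennreal_2dimen[where f = "\<lambda>z. ?w (case_prod C z)"]) simp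
  also have "\<dots> \<le> (\<Sum>i. hausdorff2_pre \<delta> (A i) + ennreal (e * (1/2) ^ Suc i))"
    by (intro suminf_le C(3)) auto
  also have "\<dots> = (\<Sum>i. hausdorff2_pre \<delta> (A i)) + (\<Sum>i. ennreal (e * (1/2) ^ Suc i))"
    by (rule suminf_add[symmetric]) auto
  also have "(\<Sum>i. ennreal (e * (1/2) ^ Suc i)) = ennreal e"
  proof (rule suminf_ennreal_eq)
    show "(\<lambda>i. e * (1/2) ^ Suc i) sums e"
      using sums_mult[OF power_half_series, of e] by simp
  qed (use \<open>0 < e\<close> in auto)
  finally show "hausdorff2_pre \<delta> (\<Union>i. A i) \<le> (\<Sum>i. hausdorff2_pre \<delta> (A i)) + ennreal e" .
qed

lemma ennreal_suminf_tail_tendsto_0: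
  fixes f :: "nat \<Rightarrow> ennreal"
  assumes "(\<Sum>i. f i) \<noteq> top"
  shows "(\<lambda>n. \<Sum>i. f (i + n)) \<longlonglongrightarrow> 0"
proof -
  define r where "r i = enn2real (f i)" for i
  have "f i < top" for i
    by (rule ennreal_suminf_lessD) (use assms in \<open>simp add: less_top\<close>)
  then have f: "f = (\<lambda>i. ennreal (r i))" by (simp add: r_def)
  have r: "0 \<le> r i" for i by (simp add: r_def)
  have sum: "summable r"
    by (rule summable_suminf_not_top) (use assms r in \<open>simp_all add: f\<close>)
  have "(\<Sum>i. f (i + n)) = ennreal (\<Sum>i. r (i + n))" for n
    unfolding f by (intro suminf_ennreal_eq summable_sums summable_ignore_initial_segment sum r)
  moreover have "(\<lambda>n. \<Sum>i. r (i + n)) \<longlonglongrightarrow> 0"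
    using suminf_exist_split[OF _ sum] by (auto simp: LIMSEQ_iff)
  ultimately show ?thesis
    using tendsto_ennrealI[of "\<lambda>n. \<Sum>i. r (i + n)" 0 sequentially] by simp
qed

lemma hausdorff2_outer_mono: "A \<subseteq> B \<Longrightarrow> hausdorff2_outer A \<le> hausdorff2_outer B"
  unfolding hausdorff2_outer_def by (intro SUP_mono) (auto intro: hausdorff2_pre_mono)

lemma hausdorff2_outer_empty: "hausdorff2_outer {} = 0"
  unfolding hausdorff2_outer_def
  by (auto intro!: antisym SUP_least simp: hausdorff2_pre_empty)

lemma hausdorff2_outer_subadditive:
  "hausdorff2_outer (\<Union>i. A i) \<le> (\<Sum>i. hausdorff2_outer (A i))"
  unfolding hausdorff2_outer_def[of "\<Union>i. A i"]
proof (rule SUP_least)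
  fix \<delta> :: real assume "\<delta> \<in> {0<..}"
  then show "hausdorff2_pre \<delta> (\<Union>i. A i) \<le> (\<Sum>i. hausdorff2_outer (A i))"
    unfolding hausdorff2_outer_def
    by (intro order_trans[OF hausdorff2_pre_subadditive] suminf_le SUP_upper) auto
qed

lemma hausdorff2_outer_Un: "hausdorff2_outer (A \<union> B) \<le> hausdorff2_outer A + hausdorff2_outer B"
proof -
  have "A \<union> B = (\<Union>i::nat. if i = 0 then A else if i = 1 then B else {})" (is "_ = (\<Union>i. ?D i)")
    by (auto split: if_splits)
  then have "hausdorff2_outer (A \<union> B) \<le> (\<Sum>i. hausdorff2_outer (?D i))"
    using hausdorff2_outer_subadditive[of ?D] by simp
  also have "\<dots> = (\<Sum>i\<in>{0, 1}. hausdorff2_outer (?D i))"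
    by (rule suminf_finite) (auto simp: hausdorff2_outer_empty)
  finally show ?thesis by simp
qed

text \<open>A set of diameter less than \<open>d\<close> cannot meet both \<open>A\<close> and \<open>B\<close>, so every fine cover of the
  union splits into a cover of \<open>A\<close> and a cover of \<open>B\<close>.\<close>

lemma hausdorff2_outer_separated:
  assumes "d > 0" and sep: "\<And>a b. a \<in> A \<Longrightarrow> b \<in> B \<Longrightarrow> d \<le> dist a b"
  shows "hausdorff2_outer A + hausdorff2_outer B \<le> hausdorff2_outer (A \<union> B)"
proof -
  let ?w = "\<lambda>D :: R3 set. ennreal (pi * (diameter D / 2)\<^sup>2)"
  have small: "hausdorff2_pre \<delta> A + hausdorff2_pre \<delta> B \<le> hausdorff2_pre \<delta> (A \<union> B)"
    if "\<delta> < d" "0 < \<delta>" for \<delta>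
    unfolding hausdorff2_pre_def[of \<delta> "A \<union> B"]
  proof (rule INF_greatest, clarify)
    fix C :: "nat \<Rightarrow> R3 set"
    assume C: "A \<union> B \<subseteq> (\<Union>i. C i)" "\<forall>i. bounded (C i) \<and> diameter (C i) \<le> \<delta>"
    define CA where "CA = (\<lambda>i. if C i \<inter> A = {} then {} else C i)"
    define CB where "CB = (\<lambda>i. if C i \<inter> B = {} then {} else C i)"
    have pre_A: "hausdorff2_pre \<delta> A \<le> (\<Sum>i. ?w (CA i))"
      unfolding hausdorff2_pre_def
    proof (intro INF_lower, clarify, intro conjI allI)
      show "A \<subseteq> (\<Union>i. CA i)" using C(1) by (fastforce simp: CA_def)
      show "bounded (CA i)" "diameter (CA i) \<le> \<delta>" for i
        using C(2) \<open>0 < \<delta>\<close> by (auto simp: CA_def)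
    qed
    have pre_B: "hausdorff2_pre \<delta> B \<le> (\<Sum>i. ?w (CB i))"
      unfolding hausdorff2_pre_def
    proof (intro INF_lower, clarify, intro conjI allI)
      show "B \<subseteq> (\<Union>i. CB i)" using C(1) by (fastforce simp: CB_def)
      show "bounded (CB i)" "diameter (CB i) \<le> \<delta>" for i
        using C(2) \<open>0 < \<delta>\<close> by (auto simp: CB_def)
    qed
    have each: "?w (CA i) + ?w (CB i) \<le> ?w (C i)" for i
    proof -
      have "C i \<inter> A = {} \<or> C i \<inter> B = {}"
      proof (rule ccontr)
        assume "\<not> ?thesis"
        then obtain a b where "a \<in> C i" "a \<in> A" "b \<in> C i" "b \<in> B" by blast
        then have "d \<le> dist a b" "dist a b \<le> diameter (C i)"
          using sep C(2) by (auto intro: diameter_bounded_bound)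
        moreover have "diameter (C i) \<le> \<delta>" using C(2) by blast
        ultimately show False using \<open>\<delta> < d\<close> by linarith
      qed
      then show ?thesis by (auto simp: CA_def CB_def)
    qed
    have "hausdorff2_pre \<delta> A + hausdorff2_pre \<delta> B \<le> (\<Sum>i. ?w (CA i)) + (\<Sum>i. ?w (CB i))"
      by (rule add_mono[OF pre_A pre_B])
    also have "\<dots> = (\<Sum>i. ?w (CA i) + ?w (CB i))"
      by (rule suminf_add) auto
    also have "\<dots> \<le> (\<Sum>i. ?w (C i))"
      by (intro suminf_le each) auto
    finally show "hausdorff2_pre \<delta> A + hausdorff2_pre \<delta> B \<le> (\<Sum>i. ?w (C i))" .
  qed
  have "(SUP \<delta>\<in>{0<..}. hausdorff2_pre \<delta> A) + (SUP \<delta>\<in>{0<..}. hausdorff2_pre \<delta> B)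
      = (SUP \<delta>\<in>{0<..}. hausdorff2_pre \<delta> A + hausdorff2_pre \<delta> B)"
  proof (rule SUP_add_directed_ennreal[symmetric])
    fix \<delta> \<delta>' :: real assume "\<delta> \<in> {0<..}" "\<delta>' \<in> {0<..}"
    then show "\<exists>\<epsilon>\<in>{0<..}. hausdorff2_pre \<delta> A + hausdorff2_pre \<delta>' B \<le> hausdorff2_pre \<epsilon> A + hausdorff2_pre \<epsilon> B"
      by (intro bexI[of _ "min \<delta> \<delta>'"] add_mono hausdorff2_pre_antimono) auto
  qed
  also have "\<dots> \<le> hausdorff2_outer (A \<union> B)"
  proof (rule SUP_least)
    fix \<delta> :: real assume "\<delta> \<in> {0<..}"
    define \<epsilon> where "\<epsilon> = min \<delta> (d / 2)"
    have \<epsilon>: "0 < \<epsilon>" "\<epsilon> < d" "\<epsilon> \<le> \<delta>" using \<open>\<delta> \<in> _\<close> \<open>d > 0\<close> by (auto simp: \<epsilon>_def)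
    have "hausdorff2_pre \<delta> A + hausdorff2_pre \<delta> B \<le> hausdorff2_pre \<epsilon> A + hausdorff2_pre \<epsilon> B"
      by (intro add_mono hausdorff2_pre_antimono \<epsilon>)
    also have "\<dots> \<le> hausdorff2_pre \<epsilon> (A \<union> B)" by (rule small) (use \<epsilon> in auto)
    also have "\<dots> \<le> hausdorff2_outer (A \<union> B)"
      unfolding hausdorff2_outer_def using \<epsilon> by (intro SUP_upper) auto
    finally show "hausdorff2_pre \<delta> A + hausdorff2_pre \<delta> B \<le> hausdorff2_outer (A \<union> B)" .
  qed
  finally show ?thesis by (simp add: hausdorff2_outer_def)
qed

lemma hausdorff2_outer_finite_separated:
  fixes R :: "nat \<Rightarrow> R3 set"
  assumes sep: "\<And>i j. i < j \<Longrightarrow> \<exists>d>0. \<forall>a\<in>R i. \<forall>b\<in>R j. d \<le> dist a b"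
  shows "(\<Sum>j<n. hausdorff2_outer (R j)) \<le> hausdorff2_outer (\<Union>j<n. R j)"
proof (induction n)
  case (Suc n)
  have "\<forall>i\<in>{..<n}. \<exists>d>0. \<forall>a\<in>R i. \<forall>b\<in>R n. d \<le> dist a b" using sep by auto
  then obtain d where d: "\<forall>i\<in>{..<n}. d i > 0 \<and> (\<forall>a\<in>R i. \<forall>b\<in>R n. d i \<le> dist a b)"
    unfolding bchoice_iff by blast
  define e where "e = Min (insert 1 (d ` {..<n}))"
  have "e > 0" using d by (auto simp: e_def)
  moreover have "e \<le> dist a b" if "a \<in> (\<Union>j<n. R j)" "b \<in> R n" for a b
  proof -
    from that(1) obtain j where j: "j < n" "a \<in> R j" by auto
    then have "e \<le> d j" by (auto simp: e_def)
    also have "d j \<le> dist a b" using d j that(2) by auto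
    finally show ?thesis .
  qed
  ultimately have sep_n: "hausdorff2_outer (\<Union>j<n. R j) + hausdorff2_outer (R n)
      \<le> hausdorff2_outer ((\<Union>j<n. R j) \<union> R n)"
    by (rule hausdorff2_outer_separated)
  have "(\<Sum>j<Suc n. hausdorff2_outer (R j)) = (\<Sum>j<n. hausdorff2_outer (R j)) + hausdorff2_outer (R n)"
    by simp
  also have "\<dots> \<le> hausdorff2_outer (\<Union>j<n. R j) + hausdorff2_outer (R n)"
    by (rule add_right_mono[OF Suc.IH])
  also note sep_n
  also have "(\<Union>j<n. R j) \<union> R n = (\<Union>j<Suc n. R j)"
    by (auto simp: less_Suc_eq)
  finally show ?case .
qed simp

text \<open>The criterion of Caratheodory. The sets \<open>S n\<close> of points of \<open>A\<close> at distance at least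
  \<open>1 / (n + 1)\<close> from \<open>F\<close> exhaust \<open>A - F\<close>, and \<open>hausdorff2_outer\<close> is additive on \<open>A \<inter> F\<close> and
  \<open>S n\<close>. What is missing from \<open>S n\<close> consists of the shells \<open>R i\<close> with \<open>i \<ge> n\<close>. Shells of even index are
  pairwise separated, as are those of odd index, so the measures of all shells are summable and
  the missing part is negligible in the limit.\<close>

lemma closed_caratheodory_measurable:
  assumes "closed F"
  shows "hausdorff2_outer (A \<inter> F) + hausdorff2_outer (A - F) \<le> hausdorff2_outer A"
proof (cases "hausdorff2_outer A = top \<or> F = {}")
  case True
  then show ?thesis by (auto simp: hausdorff2_outer_empty)
next
  case False
  then have fin: "hausdorff2_outer A < top" and "F \<noteq> {}" by (auto simp: less_top)
  define S where "S n = {x \<in> A. inverse (real (Suc n)) \<le> infdist x F}" for n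
  define R where "R n = S (Suc n) - S n" for n
  have S_sep: "inverse (real (Suc n)) \<le> dist a b" if "a \<in> A \<inter> F" "b \<in> S n" for a b n
    using that infdist_le[of a F b] by (auto simp: S_def dist_commute)
  have R_sep: "\<exists>d>0. \<forall>a\<in>R i. \<forall>b\<in>R j. d \<le> dist a b" if "Suc i < j" for i j
  proof (intro exI[of _ "inverse (real (Suc (Suc i))) - inverse (real (Suc j))"] conjI ballI)
    show "0 < inverse (real (Suc (Suc i))) - inverse (real (Suc j))"
      using that by (simp add: less_imp_inverse_less)
    fix a b assume "a \<in> R i" "b \<in> R j"
    then have "inverse (real (Suc (Suc i))) \<le> infdist a F" "infdist b F < inverse (real (Suc j))"
      by (auto simp: R_def S_def)
    moreover have "infdist a F \<le> infdist b F + dist a b" by (rule infdist_triangle)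
    ultimately show "inverse (real (Suc (Suc i))) - inverse (real (Suc j)) \<le> dist a b" by linarith
  qed
  have RA: "R n \<subseteq> A" for n by (auto simp: R_def S_def)
  have even: "(\<Sum>n<N. hausdorff2_outer (R (2 * n))) \<le> hausdorff2_outer A" for N
    by (rule order_trans[OF hausdorff2_outer_finite_separated hausdorff2_outer_mono])
      (rule R_sep, simp, use RA in blast)
  have odd: "(\<Sum>n<N. hausdorff2_outer (R (2 * n + 1))) \<le> hausdorff2_outer A" for N
    by (rule order_trans[OF hausdorff2_outer_finite_separated hausdorff2_outer_mono])
      (rule R_sep, simp, use RA in blast)
  have "(\<Sum>n<N. hausdorff2_outer (R n)) \<le> hausdorff2_outer A + hausdorff2_outer A" for N
  proof -
    have "(\<Sum>n<N. hausdorff2_outer (R n)) \<le> (\<Sum>n<2 * N. hausdorff2_outer (R n))"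
      by (rule sum_mono2) auto
    also have "\<dots> = (\<Sum>n<N. hausdorff2_outer (R (2 * n))) + (\<Sum>n<N. hausdorff2_outer (R (2 * n + 1)))"
      by (induction N) (auto simp: algebra_simps)
    also have "\<dots> \<le> hausdorff2_outer A + hausdorff2_outer A"
      by (rule add_mono[OF even odd])
    finally show ?thesis .
  qed
  then have sumR: "(\<Sum>n. hausdorff2_outer (R n)) < top"
    using fin by (intro le_less_trans[OF suminf_le_const, of _ "hausdorff2_outer A + hausdorff2_outer A"]) auto
  have tail: "(\<lambda>n. \<Sum>i. hausdorff2_outer (R (i + n))) \<longlonglongrightarrow> 0"
    using sumR by (intro ennreal_suminf_tail_tendsto_0) simp
  have cover: "hausdorff2_outer (A - F) \<le> hausdorff2_outer (S n) + (\<Sum>i. hausdorff2_outer (R (i + n)))" for n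
  proof -
    have "A - F \<subseteq> S n \<union> (\<Union>i. R (i + n))"
    proof
      fix x assume x: "x \<in> A - F"
      then have "infdist x F > 0"
        using \<open>closed F\<close> \<open>F \<noteq> {}\<close> by (simp add: infdist_pos_not_in_closed)
      then obtain m where "inverse (real (Suc m)) < infdist x F"
        using reals_Archimedean by blast
      then have "x \<in> S m" using x by (simp add: S_def less_imp_le)
      then have ex: "\<exists>m. x \<in> S m" ..
      define m where "m = (LEAST m. x \<in> S m)"
      have m: "x \<in> S m" using ex unfolding m_def by (rule LeastI_ex)
      show "x \<in> S n \<union> (\<Union>i. R (i + n))"
      proof (cases "m \<le> n")
        case True
        then have "inverse (real (Suc n)) \<le> inverse (real (Suc m))" by simp
        also have "\<dots> \<le> infdist x F" using m by (simp add: S_def)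
        finally show ?thesis using x by (simp add: S_def)
      next
        case False
        define i where "i = m - Suc n"
        have i: "m = Suc (i + n)" using False by (simp add: i_def)
        have "x \<notin> S (i + n)"
          using not_less_Least[of "i + n" "\<lambda>m. x \<in> S m"] i unfolding m_def[symmetric] by simp
        with m i have "x \<in> R (i + n)" by (simp add: R_def)
        then show ?thesis by blast
      qed
    qed
    then have "hausdorff2_outer (A - F) \<le> hausdorff2_outer (S n) + hausdorff2_outer (\<Union>i. R (i + n))"
      by (rule order_trans[OF hausdorff2_outer_mono hausdorff2_outer_Un])
    also have "\<dots> \<le> hausdorff2_outer (S n) + (\<Sum>i. hausdorff2_outer (R (i + n)))"
      by (intro add_left_mono hausdorff2_outer_subadditive)
    finally show ?thesis .
  qed
  have bound: "hausdorff2_outer (A \<inter> F) + hausdorff2_outer (A - F)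
      \<le> hausdorff2_outer A + (\<Sum>i. hausdorff2_outer (R (i + n)))" for n
  proof -
    have "hausdorff2_outer (A \<inter> F) + hausdorff2_outer (A - F)
        \<le> hausdorff2_outer (A \<inter> F) + (hausdorff2_outer (S n) + (\<Sum>i. hausdorff2_outer (R (i + n))))"
      by (rule add_left_mono[OF cover])
    also have "\<dots> = hausdorff2_outer (A \<inter> F) + hausdorff2_outer (S n) + (\<Sum>i. hausdorff2_outer (R (i + n)))"
      by (simp add: add.assoc)
    also have "hausdorff2_outer (A \<inter> F) + hausdorff2_outer (S n) \<le> hausdorff2_outer (A \<inter> F \<union> S n)"
      by (rule hausdorff2_outer_separated[of "inverse (real (Suc n))"]) (simp, rule S_sep)
    also have "hausdorff2_outer (A \<inter> F \<union> S n) \<le> hausdorff2_outer A"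
      by (rule hausdorff2_outer_mono) (auto simp: S_def)
    finally show ?thesis by (simp add: add_right_mono)
  qed
  have "(\<lambda>n. hausdorff2_outer A + (\<Sum>i. hausdorff2_outer (R (i + n)))) \<longlonglongrightarrow> hausdorff2_outer A + 0"
    by (intro tendsto_add tendsto_const tail)
  then have "hausdorff2_outer (A \<inter> F) + hausdorff2_outer (A - F) \<le> hausdorff2_outer A + 0"
    by (rule LIMSEQ_le_const) (intro exI[of _ 0] allI impI bound)
  then show ?thesis by simp
qed

text \<open>Needed before anything else can be said about \<open>hausdorff2\<close>: a function that is not countably
  additive on the given \<open>\<sigma>\<close>-algebra is replaced by zero in \<open>measure_of\<close>.\<close>

lemma emeasure_hausdorff2:
  assumes "A \<in> sets borel"
  shows "emeasure hausdorff2 A = hausdorff2_outer A"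
proof -
  interpret P: sigma_algebra UNIV "UNIV :: R3 set set"
    using sigma_algebra_Pow[of UNIV] by simp
  let ?L = "lambda_system UNIV UNIV hausdorff2_outer"
  have "outer_measure_space UNIV hausdorff2_outer"
    by (auto simp: outer_measure_space_def positive_def increasing_def countably_subadditive_def
      hausdorff2_outer_empty hausdorff2_outer_mono hausdorff2_outer_subadditive)
  then have ms: "measure_space UNIV ?L hausdorff2_outer"
    by (rule P.caratheodory_lemma)
  have "F \<in> ?L" if "closed F" for F :: "R3 set"
  proof -
    have "hausdorff2_outer (x \<inter> F) + hausdorff2_outer (x - F) = hausdorff2_outer x" for x
      using closed_caratheodory_measurable[OF that, of x] hausdorff2_outer_Un[of "x \<inter> F" "x - F"]
      by (intro antisym) (simp_all add: Int_Diff_Un)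
    then show ?thesis by (simp add: P.lambda_system_eq)
  qed
  then have "sigma_sets UNIV (Collect closed) \<subseteq> ?L"
    using ms by (intro sigma_algebra.sigma_sets_subset) (auto simp: measure_space_def)
  then have "sets (borel :: R3 measure) \<subseteq> ?L"
    unfolding borel_eq_closed by (subst sets_measure_of) simp_all
  moreover have "sigma_algebra UNIV (sets (borel :: R3 measure))"
    using sets.sigma_algebra_axioms[of "borel :: R3 measure"] by simp
  ultimately have borel_ms: "measure_space UNIV (sets borel) hausdorff2_outer"
    using ms measure_down by blast
  have "sigma_sets UNIV (sets borel) = sets (borel :: R3 measure)"
    using sets.sigma_sets_eq[of "borel :: R3 measure"] by simp
  with borel_ms assms show ?thesis
    unfolding hausdorff2_def emeasure_measure_of_conv by simp
qed

lemma sets_hausdorff2 [simp, measurable_cong]: "sets hausdorff2 = sets borel"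
  using sets.sigma_sets_eq[of "borel :: R3 measure"]
  by (simp add: hausdorff2_def)

lemma space_hausdorff2 [simp]: "space hausdorff2 = UNIV"
  by (simp add: hausdorff2_def)

section \<open>Lower bounds for areas\<close>

lemma emeasure_lborel_square:
  assumes "0 \<le> d"
  shows "emeasure lborel (cbox (a - d, b - d) (a + d, b + d :: real)) = ennreal (4 * d\<^sup>2)"
proof -
  have "(\<Prod>i\<in>Basis. ((a + d, b + d) - (a - d, b - d)) \<bullet> i) = 4 * d\<^sup>2"
    by (simp add: Basis_prod_def prod.union_disjoint prod.reindex inj_on_def power2_eq_square)
  then show ?thesis
    using assms by (subst emeasure_lborel_cbox) (auto simp: Basis_prod_def)
qed

text \<open>The two coordinates \<open>z \<bullet> e\<^sub>1\<close> and \<open>z \<bullet> e\<^sub>2\<close> do not increase distances, so the projection to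
  them sends a set of diameter \<open>d\<close> into a square of side \<open>2 d\<close>. If the projection of \<open>A\<close> contains a square of side \<open>2 \<rho>\<close>,
  comparing Lebesgue areas shows that the sum of the squared diameters over any cover is at
  least \<open>\<rho>\<^sup>2\<close>. The constant \<open>\<pi> / 4\<close> is not sharp: that would take the isodiametric inequality.\<close>

lemma hausdorff2_outer_ge_projection:
  fixes e\<^sub>1 e\<^sub>2 :: R3 and \<rho> u\<^sub>1 u\<^sub>2 :: real
  assumes "0 \<le> \<rho>" and e: "norm e\<^sub>1 \<le> 1" "norm e\<^sub>2 \<le> 1"
    and proj: "\<And>a b. \<bar>a\<bar> \<le> \<rho> \<Longrightarrow> \<bar>b\<bar> \<le> \<rho> \<Longrightarrow> \<exists>z\<in>A. z \<bullet> e\<^sub>1 = u\<^sub>1 + a \<and> z \<bullet> e\<^sub>2 = u\<^sub>2 + b"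
  shows "ennreal (pi / 4 * \<rho>\<^sup>2) \<le> hausdorff2_outer A"
proof -
  have "ennreal (pi / 4 * \<rho>\<^sup>2) \<le> hausdorff2_pre 1 A"
    unfolding hausdorff2_pre_def
  proof (rule INF_greatest, clarify)
    fix C :: "nat \<Rightarrow> R3 set"
    assume C: "A \<subseteq> (\<Union>i. C i)" "\<forall>i. bounded (C i) \<and> diameter (C i) \<le> 1"
    define z where "z i = (SOME z. z \<in> C i)" for i
    let ?d = "\<lambda>i. diameter (C i)"
    define B where "B i = cbox (z i \<bullet> e\<^sub>1 - ?d i, z i \<bullet> e\<^sub>2 - ?d i) (z i \<bullet> e\<^sub>1 + ?d i, z i \<bullet> e\<^sub>2 + ?d i)" for i
    have d0: "0 \<le> ?d i" for i using C(2) by (simp add: diameter_ge_0)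
    have "cbox (u\<^sub>1 - \<rho>, u\<^sub>2 - \<rho>) (u\<^sub>1 + \<rho>, u\<^sub>2 + \<rho>) \<subseteq> (\<Union>i. B i)"
    proof
      fix q assume q: "q \<in> cbox (u\<^sub>1 - \<rho>, u\<^sub>2 - \<rho>) (u\<^sub>1 + \<rho>, u\<^sub>2 + \<rho>)"
      obtain s t where st: "q = (s, t)" by (cases q)
      have "\<bar>s - u\<^sub>1\<bar> \<le> \<rho>" "\<bar>t - u\<^sub>2\<bar> \<le> \<rho>"
        using q by (auto simp: st cbox_Pair_eq abs_le_iff)
      then obtain w where w: "w \<in> A" "w \<bullet> e\<^sub>1 = s" "w \<bullet> e\<^sub>2 = t"
        using proj[of "s - u\<^sub>1" "t - u\<^sub>2"] by auto
      then obtain i where i: "w \<in> C i" using C(1) by blast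
      then have "z i \<in> C i" unfolding z_def by (rule someI)
      then have n: "norm (w - z i) \<le> ?d i"
        using diameter_bounded_bound[of "C i" w "z i"] C(2) i by (simp add: dist_norm)
      have "\<bar>w \<bullet> e - z i \<bullet> e\<bar> \<le> ?d i" if "norm e \<le> 1" for e
      proof -
        have "\<bar>(w - z i) \<bullet> e\<bar> \<le> norm (w - z i) * norm e" by (rule Cauchy_Schwarz_ineq2)
        also have "\<dots> \<le> norm (w - z i) * 1" by (intro mult_left_mono that) simp
        finally show ?thesis using n by (simp add: inner_diff_left)
      qed
      from this[OF e(1)] this[OF e(2)] have "q \<in> B i"
        by (auto simp: B_def st w cbox_Pair_eq abs_le_iff)
      then show "q \<in> (\<Union>i. B i)" by blast
    qed
    then have "emeasure lborel (cbox (u\<^sub>1 - \<rho>, u\<^sub>2 - \<rho>) (u\<^sub>1 + \<rho>, u\<^sub>2 + \<rho>)) \<le> emeasure lborel (\<Union>i. B i)"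
      by (intro emeasure_mono) (auto simp: B_def)
    also have "\<dots> \<le> (\<Sum>i. emeasure lborel (B i))"
      by (rule emeasure_subadditive_countably) (auto simp: B_def)
    finally have *: "ennreal (4 * \<rho>\<^sup>2) \<le> (\<Sum>i. ennreal (4 * (?d i)\<^sup>2))"
      using \<open>0 \<le> \<rho>\<close> d0 by (simp add: B_def emeasure_lborel_square)
    \<comment> \<open>The factor \<open>\<pi> / 16\<close> converts the area \<open>4 d\<^sup>2\<close> of a square into the weight \<open>\<pi> (d / 2)\<^sup>2\<close>.\<close>
    have "ennreal (pi / 4 * \<rho>\<^sup>2) = ennreal (pi / 16) * ennreal (4 * \<rho>\<^sup>2)"
      by (subst ennreal_mult[symmetric]) auto
    also have "\<dots> \<le> ennreal (pi / 16) * (\<Sum>i. ennreal (4 * (?d i)\<^sup>2))"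
      by (rule mult_left_mono[OF *]) simp
    also have "\<dots> = (\<Sum>i. ennreal (pi / 16) * ennreal (4 * (?d i)\<^sup>2))" by simp
    also have "\<dots> = (\<Sum>i. ennreal (pi * (?d i / 2)\<^sup>2))"
      by (subst ennreal_mult[symmetric]) (auto simp: power2_eq_square field_simps)
    finally show "ennreal (pi / 4 * \<rho>\<^sup>2) \<le> (\<Sum>i. ennreal (pi * (?d i / 2)\<^sup>2))" .
  qed
  also have "\<dots> \<le> hausdorff2_outer A"
    unfolding hausdorff2_outer_def by (rule SUP_upper) simp
  finally show ?thesis .
qed

lemma inside_outside_crossing:
  fixes p w :: "'a::euclidean_space"
  assumes "p - w \<in> inside M" "p + w \<in> outside M"
  obtains u where "\<bar>u\<bar> \<le> 1" "p + u *\<^sub>R w \<in> M"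
proof -
  have "closed_segment (p - w) (p + w) \<inter> M \<noteq> {}"
  proof
    assume "closed_segment (p - w) (p + w) \<inter> M = {}"
    then have "connected_component (- M) (p - w) (p + w)"
      unfolding connected_component_def
      by (intro exI[of _ "closed_segment (p - w) (p + w)"]) (auto intro: convex_connected)
    then have "p + w \<in> inside M" using assms(1) by (rule inside_same_component)
    then show False using assms(2) inside_Int_outside by blast
  qed
  then obtain s where s: "0 \<le> s" "s \<le> 1" "(1 - s) *\<^sub>R (p - w) + s *\<^sub>R (p + w) \<in> M"
    by (auto simp: closed_segment_def)
  have "(2 * s - 1) *\<^sub>R w = s *\<^sub>R w + s *\<^sub>R w - w"
    by (simp only: mult_2 scaleR_left_diff_distrib scaleR_left_distrib scaleR_one)
  then have "(1 - s) *\<^sub>R (p - w) + s *\<^sub>R (p + w) = p + (2 * s - 1) *\<^sub>R w"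
    by (simp add: algebra_simps)
  then show ?thesis using that[of "2 * s - 1"] s by simp
qed

lemma norm_add_square: "(norm (x + y))\<^sup>2 = (norm x)\<^sup>2 + 2 * (x \<bullet> y) + (norm (y :: 'a :: real_inner))\<^sup>2"
  by (simp add: power2_norm_eq_inner inner_add_left inner_add_right inner_commute)

lemma orthonormal_plane:
  fixes n :: R3
  obtains e\<^sub>1 e\<^sub>2 where "norm e\<^sub>1 = 1" "norm e\<^sub>2 = 1" "e\<^sub>1 \<bullet> e\<^sub>2 = 0" "e\<^sub>1 \<bullet> n = 0" "e\<^sub>2 \<bullet> n = 0"
proof -
  have unit: "norm (y /\<^sub>R norm y) = 1" "(y /\<^sub>R norm y) \<bullet> w = 0 \<longleftrightarrow> y \<bullet> w = 0" if "y \<noteq> 0" for y w :: R3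
    using that by simp_all
  obtain y where y: "y \<noteq> 0" "y \<bullet> n = 0"
    using orthogonal_to_vector_exists[of n] by (auto simp: orthogonal_def inner_commute)
  have "dim {n, y} < DIM(R3)"
  proof -
    have "dim {n, y} \<le> card {n, y}" by (intro dim_le_card span_superset) auto
    also have "\<dots> \<le> 2" by (simp add: card_insert_if)
    finally show ?thesis by simp
  qed
  then obtain z where z: "z \<noteq> 0" "\<And>w. w \<in> span {n, y} \<Longrightarrow> orthogonal z w"
    using orthogonal_to_subspace_exists by blast
  have "orthogonal z n" "orthogonal z y" by (rule z(2), rule span_base, simp)+
  then have "z \<bullet> n = 0" "z \<bullet> y = 0" by (simp_all add: orthogonal_def)
  then show ?thesis
    using that[of "y /\<^sub>R norm y" "z /\<^sub>R norm z"] unit[OF y(1)] unit[OF z(1)] y z(1)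
    by (simp add: inner_commute)
qed

text \<open>The form in which the projection bound is applied: every normal line through the disc of
  radius \<open>2 \<rho>\<close> in the plane through \<open>x\<close> orthogonal to \<open>n\<close> meets \<open>A\<close>.\<close>

lemma hausdorff2_outer_ge_graph:
  fixes x n :: R3
  assumes "0 \<le> \<rho>"
    and over: "\<And>y. y \<bullet> n = 0 \<Longrightarrow> norm y \<le> 2 * \<rho> \<Longrightarrow> \<exists>h. x + y + h *\<^sub>R n \<in> A"
  shows "ennreal (pi / 4 * \<rho>\<^sup>2) \<le> hausdorff2_outer A"
proof -
  obtain e\<^sub>1 e\<^sub>2 where e: "norm e\<^sub>1 = 1" "norm e\<^sub>2 = 1" "e\<^sub>1 \<bullet> e\<^sub>2 = 0" "e\<^sub>1 \<bullet> n = 0" "e\<^sub>2 \<bullet> n = 0"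
    by (rule orthonormal_plane)
  show ?thesis
  proof (rule hausdorff2_outer_ge_projection[of _ e\<^sub>1 e\<^sub>2 _ "x \<bullet> e\<^sub>1" "x \<bullet> e\<^sub>2"])
    fix a b :: real assume ab: "\<bar>a\<bar> \<le> \<rho>" "\<bar>b\<bar> \<le> \<rho>"
    define y where "y = a *\<^sub>R e\<^sub>1 + b *\<^sub>R e\<^sub>2"
    have "norm y \<le> norm (a *\<^sub>R e\<^sub>1) + norm (b *\<^sub>R e\<^sub>2)" unfolding y_def by (rule norm_triangle_ineq)
    then have "norm y \<le> 2 * \<rho>" using ab e by simp
    moreover have "y \<bullet> n = 0" using e by (simp add: y_def inner_add_left)
    ultimately obtain h where "x + y + h *\<^sub>R n \<in> A" using over by blast
    moreover have "(x + y + h *\<^sub>R n) \<bullet> e\<^sub>1 = x \<bullet> e\<^sub>1 + a" "(x + y + h *\<^sub>R n) \<bullet> e\<^sub>2 = x \<bullet> e\<^sub>2 + b"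
      using e unfolding y_def inner_add_left inner_scaleR_left
      by (simp_all add: inner_commute[of e\<^sub>2 e\<^sub>1] inner_commute[of n] norm_eq_1)
    ultimately show "\<exists>z\<in>A. z \<bullet> e\<^sub>1 = x \<bullet> e\<^sub>1 + a \<and> z \<bullet> e\<^sub>2 = x \<bullet> e\<^sub>2 + b"
      by blast
  qed (use e assms(1) in auto)
qed

text \<open>Near \<open>x\<close> there are small balls on the inner and on the outer side, and every segment in
  normal direction that joins them crosses \<open>M\<close>. The size of these balls depends on
  \<open>x\<close> and \<open>M\<close>, so the bound is only qualitative, but it is enough to recognise \<open>M\<close> as the support of the mass of its
  varifolds.\<close>

lemma hausdorff2_outer_ball_pos:
  assumes "closed M" "outer_unit_normal M \<nu>" "x \<in> M" "\<epsilon> > 0"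
  shows "hausdorff2_outer (M \<inter> ball x \<epsilon>) > 0"
proof -
  obtain t\<^sub>0 where "t\<^sub>0 > 0"
    and t\<^sub>0: "\<And>t. 0 < t \<Longrightarrow> t < t\<^sub>0 \<Longrightarrow> x + t *\<^sub>R \<nu> x \<in> outside M \<and> x - t *\<^sub>R \<nu> x \<in> inside M"
    and n1: "norm (\<nu> x) = 1"
    using assms unfolding outer_unit_normal_def by fastforce
  define t where "t = min (t\<^sub>0 / 2) (\<epsilon> / 2)"
  have t: "0 < t" "t < t\<^sub>0" "t \<le> \<epsilon> / 2" using \<open>t\<^sub>0 > 0\<close> \<open>\<epsilon> > 0\<close> by (auto simp: t_def)
  have "open (outside M)" "open (inside M)" using \<open>closed M\<close> by (auto simp: open_outside open_inside)
  moreover have "x + t *\<^sub>R \<nu> x \<in> outside M" "x - t *\<^sub>R \<nu> x \<in> inside M" using t\<^sub>0 t by auto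
  ultimately obtain d\<^sub>1 d\<^sub>2 where "d\<^sub>1 > 0" "ball (x + t *\<^sub>R \<nu> x) d\<^sub>1 \<subseteq> outside M"
      and "d\<^sub>2 > 0" "ball (x - t *\<^sub>R \<nu> x) d\<^sub>2 \<subseteq> inside M"
    by (meson open_contains_ball)
  define d where "d = min (min d\<^sub>1 d\<^sub>2) (\<epsilon> / 2) / 4"
  have d: "0 < d" "2 * d < d\<^sub>1" "2 * d < d\<^sub>2" "2 * d < \<epsilon> / 2"
    using \<open>d\<^sub>1 > 0\<close> \<open>d\<^sub>2 > 0\<close> \<open>\<epsilon> > 0\<close> by (auto simp: d_def min_def)
  have "ennreal (pi / 4 * d\<^sup>2) \<le> hausdorff2_outer (M \<inter> ball x \<epsilon>)"
  proof (rule hausdorff2_outer_ge_graph[of d "\<nu> x" x])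
    fix y :: R3 assume y: "norm y \<le> 2 * d"
    have "x + y - t *\<^sub>R \<nu> x \<in> inside M" "x + y + t *\<^sub>R \<nu> x \<in> outside M"
      using \<open>ball (x + t *\<^sub>R \<nu> x) d\<^sub>1 \<subseteq> outside M\<close> \<open>ball (x - t *\<^sub>R \<nu> x) d\<^sub>2 \<subseteq> inside M\<close> y d
      using mem_ball[of "x + y - t *\<^sub>R \<nu> x" "x - t *\<^sub>R \<nu> x" d\<^sub>2] mem_ball[of "x + y + t *\<^sub>R \<nu> x" "x + t *\<^sub>R \<nu> x" d\<^sub>1]
      by (auto simp: dist_norm)
    then obtain u where u: "\<bar>u\<bar> \<le> 1" "x + y + u *\<^sub>R (t *\<^sub>R \<nu> x) \<in> M"
      by (rule inside_outside_crossing)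
    define h where "h = u * t"
    have zM: "x + y + h *\<^sub>R \<nu> x \<in> M" using u(2) by (simp add: h_def)
    have "\<bar>h\<bar> \<le> t" using u(1) t by (simp add: h_def abs_mult mult_left_le_one_le)
    then have "norm (y + h *\<^sub>R \<nu> x) < \<epsilon>"
      using norm_triangle_ineq[of y "h *\<^sub>R \<nu> x"] y d t n1 by simp
    then have "x + y + h *\<^sub>R \<nu> x \<in> M \<inter> ball x \<epsilon>"
      using zM by (simp add: dist_norm norm_minus_commute add.assoc flip: norm_minus_cancel[of "y + h *\<^sub>R \<nu> x"])
    then show "\<exists>h. x + y + h *\<^sub>R \<nu> x \<in> M \<inter> ball x \<epsilon>" by blast
  qed (use d in simp)
  moreover have "0 < ennreal (pi / 4 * d\<^sup>2)" using d by simp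
  ultimately show ?thesis by (rule less_le_trans[rotated])
qed

section \<open>Surfaces with a uniform ball condition\<close>

lemma has_vector_derivative_imp_quotient_tendsto:
  fixes f :: "real \<Rightarrow> 'a::real_normed_vector"
  assumes "(f has_vector_derivative v) (at 0)"
  shows "((\<lambda>t. (f t - f 0) /\<^sub>R t) \<longlongrightarrow> v) (at 0)"
proof -
  have "((\<lambda>h. norm (f (0 + h) - f 0 - h *\<^sub>R v) / norm h) \<longlongrightarrow> 0) (at 0)"
    using assms unfolding has_vector_derivative_def has_derivative_at by blast
  moreover have "\<forall>\<^sub>F h in at (0::real). norm (f (0 + h) - f 0 - h *\<^sub>R v) / norm h = norm ((f h - f 0) /\<^sub>R h - v)"
    unfolding eventually_at_filter
  proof (rule always_eventually, rule allI, rule impI, rule impI)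
    fix h :: real assume "h \<noteq> 0"
    then have "(f h - f 0) /\<^sub>R h - v = (f h - f 0 - h *\<^sub>R v) /\<^sub>R h"
      by (simp add: scaleR_diff_right)
    then show "norm (f (0 + h) - f 0 - h *\<^sub>R v) / norm h = norm ((f h - f 0) /\<^sub>R h - v)"
      by (simp add: divide_inverse_commute)
  qed
  ultimately have "((\<lambda>h. norm ((f h - f 0) /\<^sub>R h - v)) \<longlongrightarrow> 0) (at 0)"
    by (rule Lim_transform_eventually)
  then show ?thesis by (subst Lim_null) (rule tendsto_norm_zero_cancel)
qed

locale ball_surface =
  fixes M :: "R3 set" and \<nu> :: "R3 \<Rightarrow> R3" and r :: real
  assumes compact: "compact M"
    and normal: "outer_unit_normal M \<nu>"
    and balls: "uniform_ball_condition r M \<nu>"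
    and r_pos: "0 < r"
begin

lemma norm_normal: "x \<in> M \<Longrightarrow> norm (\<nu> x) = 1"
  using normal by (auto simp: outer_unit_normal_def)

lemma exterior_ball: "x \<in> M \<Longrightarrow> ball (x + r *\<^sub>R \<nu> x) r \<subseteq> outside M"
  and interior_ball: "x \<in> M \<Longrightarrow> ball (x - r *\<^sub>R \<nu> x) r \<subseteq> inside M"
proof -
  assume x: "x \<in> M"
  obtain \<epsilon> where "\<epsilon> > 0" and \<epsilon>: "\<And>t. 0 < t \<Longrightarrow> t < \<epsilon> \<Longrightarrow> x + t *\<^sub>R \<nu> x \<in> outside M \<and> x - t *\<^sub>R \<nu> x \<in> inside M"
    using normal x unfolding outer_unit_normal_def by fastforce
  define t where "t = min (\<epsilon> / 2) r"
  have t: "0 < t" "t < \<epsilon>" "t \<le> r" using \<open>\<epsilon> > 0\<close> r_pos by (auto simp: t_def)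
  have "x + t *\<^sub>R \<nu> x - (x + r *\<^sub>R \<nu> x) = (t - r) *\<^sub>R \<nu> x" "x - t *\<^sub>R \<nu> x - (x - r *\<^sub>R \<nu> x) = (r - t) *\<^sub>R \<nu> x"
    by (simp_all add: algebra_simps)
  then have inball: "x + t *\<^sub>R \<nu> x \<in> ball (x + r *\<^sub>R \<nu> x) r" "x - t *\<^sub>R \<nu> x \<in> ball (x - r *\<^sub>R \<nu> x) r"
    using t norm_normal[OF x] by (simp_all add: dist_norm norm_minus_commute)
  have disj: "ball (x + r *\<^sub>R \<nu> x) r \<subseteq> - M" "ball (x - r *\<^sub>R \<nu> x) r \<subseteq> - M"
    using balls x by (auto simp: uniform_ball_condition_def)
  have "connected_component (- M) (x + t *\<^sub>R \<nu> x) w" if "w \<in> ball (x + r *\<^sub>R \<nu> x) r" for w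
    unfolding connected_component_def
    by (intro exI[of _ "ball (x + r *\<^sub>R \<nu> x) r"] conjI connected_ball disj inball that)
  then show "ball (x + r *\<^sub>R \<nu> x) r \<subseteq> outside M" 
    using \<epsilon>[OF t(1,2)] outside_same_component by blast
  have "connected_component (- M) (x - t *\<^sub>R \<nu> x) w" if "w \<in> ball (x - r *\<^sub>R \<nu> x) r" for w
    unfolding connected_component_def
    by (intro exI[of _ "ball (x - r *\<^sub>R \<nu> x) r"] conjI connected_ball disj inball that)
  then show "ball (x - r *\<^sub>R \<nu> x) r \<subseteq> inside M" 
    using \<epsilon>[OF t(1,2)] inside_same_component by blast
qed

text \<open>The inner and the outer balls are disjoint because they lie in \<open>inside M\<close> and
  \<open>outside M\<close>.\<close>

lemma centers_far:
  assumes "x \<in> M" "y \<in> M"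
  shows "2 * r \<le> norm (x + r *\<^sub>R \<nu> x - (y - r *\<^sub>R \<nu> y))"
proof (rule ccontr)
  let ?a = "x + r *\<^sub>R \<nu> x" and ?b = "y - r *\<^sub>R \<nu> y"
  assume "\<not> ?thesis"
  then have "midpoint ?a ?b \<in> ball ?a r" "midpoint ?a ?b \<in> ball ?b r"
    by (simp_all add: dist_midpoint) (simp_all add: dist_norm)
  then show False
    using exterior_ball[OF assms(1)] interior_ball[OF assms(2)] inside_Int_outside by blast
qed

text \<open>Adding the squares of the two inequalities that \<open>centers_far\<close> gives for \<open>(x, y)\<close> and
  \<open>(y, x)\<close> cancels the mixed terms and leaves
  \<open>r\<^sup>2 |\<nu> x + \<nu> y|\<^sup>2 + |x - y|\<^sup>2 \<ge> 4 r\<^sup>2\<close>, while \<open>|\<nu> x + \<nu> y|\<^sup>2 = 4 - |\<nu> x - \<nu> y|\<^sup>2\<close>.\<close>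

lemma normal_lipschitz:
  assumes "x \<in> M" "y \<in> M"
  shows "norm (\<nu> x - \<nu> y) \<le> norm (x - y) / r"
proof -
  let ?d = "x - y" and ?s = "r *\<^sub>R (\<nu> x + \<nu> y)"
  have "2 * r \<le> norm (?d + ?s)" "2 * r \<le> norm (?s + - ?d)"
    using centers_far[OF assms] centers_far[OF assms(2,1)] by (simp_all add: algebra_simps)
  then have "(2 * r)\<^sup>2 \<le> (norm (?d + ?s))\<^sup>2" "(2 * r)\<^sup>2 \<le> (norm (?s + - ?d))\<^sup>2"
    using r_pos by (simp_all only: power_mono mult_nonneg_nonneg zero_le_numeral less_imp_le)
  then have "8 * r\<^sup>2 \<le> 2 * (norm ?d)\<^sup>2 + 2 * (norm ?s)\<^sup>2"
    unfolding norm_add_square by (simp only: inner_minus_right norm_minus_cancel inner_commute[of ?s ?d])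
      (simp add: power_mult_distrib)
  moreover have "(norm ?s)\<^sup>2 = r\<^sup>2 * (4 - (norm (\<nu> x - \<nu> y))\<^sup>2)"
    using norm_normal assms norm_add_square[of "\<nu> x" "\<nu> y"] norm_add_square[of "\<nu> x" "- \<nu> y"] r_pos
    by (simp add: power_mult_distrib)
  ultimately have "(r * norm (\<nu> x - \<nu> y))\<^sup>2 \<le> (norm ?d)\<^sup>2"
    by (simp add: power_mult_distrib algebra_simps)
  then have "r * norm (\<nu> x - \<nu> y) \<le> norm ?d"
    by (rule power2_le_imp_le) simp
  then show ?thesis using r_pos by (simp add: field_simps)
qed

lemma normal_component_quadratic:
  assumes "x \<in> M" "y \<in> M"
  shows "\<bar>(y - x) \<bullet> \<nu> x\<bar> \<le> (norm (y - x))\<^sup>2 / (2 * r)"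
proof -
  have "y \<notin> ball (x + r *\<^sub>R \<nu> x) r" "y \<notin> ball (x - r *\<^sub>R \<nu> x) r"
    using balls assms unfolding uniform_ball_condition_def by blast+
  then have "r \<le> norm ((y - x) + (- r) *\<^sub>R \<nu> x)" "r \<le> norm ((y - x) + r *\<^sub>R \<nu> x)"
    by (simp_all add: dist_norm norm_minus_commute algebra_simps)
  then have "r\<^sup>2 \<le> (norm ((y - x) + (- r) *\<^sub>R \<nu> x))\<^sup>2" "r\<^sup>2 \<le> (norm ((y - x) + r *\<^sub>R \<nu> x))\<^sup>2"
    using r_pos by (auto intro: power_mono)
  then have "2 * r * \<bar>(y - x) \<bullet> \<nu> x\<bar> \<le> (norm (y - x))\<^sup>2"
    unfolding norm_add_square using norm_normal[OF assms(1)] r_pos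
    by (auto simp: abs_if)
  then show ?thesis using r_pos by (simp add: field_simps)
qed

text \<open>Over every point \<open>x + y\<close> of the tangent plane with small \<open>y\<close> the surface has a point whose
  height is quadratic in \<open>y\<close>: at height \<open>\<plusminus>2 |y|\<^sup>2 / r\<close> one is already in the outer, respectively the inner,
  tangent ball.\<close>

lemma crossing:
  assumes x: "x \<in> M" and y: "y \<bullet> \<nu> x = 0" "norm y \<le> r / 2"
  obtains h where "\<bar>h\<bar> \<le> 2 * (norm y)\<^sup>2 / r" "x + y + h *\<^sub>R \<nu> x \<in> M"
proof (cases "y = 0")
  case True
  then show ?thesis using that[of 0] x by simp
next
  case False
  define s where "s = 2 * (norm y)\<^sup>2 / r"
  have s0: "0 \<le> s" using r_pos by (simp add: s_def)
  have rs: "r * s = 2 * (norm y)\<^sup>2" using r_pos by (simp add: s_def)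
  have "s \<le> norm y"
  proof -
    have "s = norm y * (2 * norm y / r)" by (simp add: s_def power2_eq_square)
    also have "\<dots> \<le> norm y * 1" using y r_pos by (intro mult_left_mono) (auto simp: field_simps)
    finally show ?thesis by simp
  qed
  then have s2: "s\<^sup>2 \<le> (norm y)\<^sup>2" using s0 by (intro power_mono) auto
  have "0 < (norm y)\<^sup>2" using False by simp
  then have s3: "s\<^sup>2 < 3 * (norm y)\<^sup>2" using s2 by linarith
  have "(norm (y + (s - r) *\<^sub>R \<nu> x))\<^sup>2 < r\<^sup>2" "(norm (y + (r - s) *\<^sub>R \<nu> x))\<^sup>2 < r\<^sup>2"
    unfolding norm_add_square using y norm_normal[OF x] s3 rs
    by (simp_all add: power2_diff mult.commute[of s r] mult.assoc)
  then have "norm (y + (s - r) *\<^sub>R \<nu> x) < r" "norm (y + (r - s) *\<^sub>R \<nu> x) < r"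
    using r_pos power_less_imp_less_base less_imp_le by blast+
  then have "x + y + s *\<^sub>R \<nu> x \<in> ball (x + r *\<^sub>R \<nu> x) r" "x + y - s *\<^sub>R \<nu> x \<in> ball (x - r *\<^sub>R \<nu> x) r"
    by (simp_all add: dist_norm norm_minus_commute algebra_simps)
  then have "x + y + s *\<^sub>R \<nu> x \<in> outside M" "x + y - s *\<^sub>R \<nu> x \<in> inside M"
    using exterior_ball[OF x] interior_ball[OF x] by auto
  from inside_outside_crossing[OF this(2,1)] obtain u
    where u: "\<bar>u\<bar> \<le> 1" "x + y + u *\<^sub>R (s *\<^sub>R \<nu> x) \<in> M" .
  have "x + y + (u * s) *\<^sub>R \<nu> x \<in> M" using u(2) by simp
  moreover have "\<bar>u * s\<bar> \<le> s"
    using u(1) s0 by (simp add: abs_mult mult_left_le_one_le)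
  ultimately show ?thesis using that unfolding s_def by blast
qed

text \<open>The crossing points over the line spanned by \<open>v\<close> form a curve in \<open>M\<close>. They are chosen
  without any continuity, but their height is quadratic in \<open>t\<close>, which gives the derivative at \<open>0\<close>.\<close>

lemma curve_through:
  assumes x: "x \<in> M" and v: "v \<bullet> \<nu> x = 0"
  obtains c where "c 0 = x" "\<And>t. c t \<in> M" "(c has_vector_derivative v) (at (0::real))"
proof -
  have "\<exists>z. z \<in> M \<and> (norm (t *\<^sub>R v) \<le> r / 2 \<longrightarrow> norm (z - x - t *\<^sub>R v) \<le> 2 * (norm (t *\<^sub>R v))\<^sup>2 / r)" for t
  proof (cases "norm (t *\<^sub>R v) \<le> r / 2")
    case True
    obtain h where "\<bar>h\<bar> \<le> 2 * (norm (t *\<^sub>R v))\<^sup>2 / r" "x + t *\<^sub>R v + h *\<^sub>R \<nu> x \<in> M"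
      using crossing[OF x _ True] v by auto
    then show ?thesis
      using norm_normal[OF x] by (intro exI[of _ "x + t *\<^sub>R v + h *\<^sub>R \<nu> x"]) simp
  qed (use x in auto)
  then obtain c where c: "\<And>t. c t \<in> M"
      "\<And>t. norm (t *\<^sub>R v) \<le> r / 2 \<Longrightarrow> norm (c t - x - t *\<^sub>R v) \<le> 2 * (norm (t *\<^sub>R v))\<^sup>2 / r"
    by metis
  have c0: "c 0 = x" using c(2)[of 0] r_pos by simp
  have "\<forall>\<^sub>F t in at 0. norm (t *\<^sub>R v) \<le> r / 2"
  proof -
    have "((\<lambda>t. norm (t *\<^sub>R v)) \<longlongrightarrow> norm (0 *\<^sub>R v)) (at 0)" by (intro tendsto_intros)
    then show ?thesis
      using order_tendstoD(2)[of "\<lambda>t. norm (t *\<^sub>R v)" 0 "at 0" "r / 2"] r_pos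
      by (auto elim: eventually_mono)
  qed
  then have "\<forall>\<^sub>F t in at 0. norm (norm (c (0 + t) - c 0 - t *\<^sub>R v) / norm t) \<le> 2 * (norm v)\<^sup>2 / r * \<bar>t\<bar>"
  proof eventually_elim
    case (elim t)
    have "norm (c t - x - t *\<^sub>R v) \<le> (2 * (norm v)\<^sup>2 / r * \<bar>t\<bar>) * \<bar>t\<bar>"
      using c(2)[OF elim] by (simp add: power_mult_distrib power2_eq_square mult_ac)
    then show ?case
      using r_pos by (cases "t = 0") (simp_all add: c0 pos_divide_le_eq)
  qed
  moreover have "((\<lambda>t. 2 * (norm v)\<^sup>2 / r * \<bar>t\<bar>) \<longlongrightarrow> 0) (at 0)"
    using r_pos by (auto intro!: tendsto_eq_intros)
  ultimately have "((\<lambda>t. norm (c (0 + t) - c 0 - t *\<^sub>R v) / norm t) \<longlongrightarrow> 0) (at 0)"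
    by (rule Lim_null_comparison)
  then have "(c has_vector_derivative v) (at 0)"
    unfolding has_vector_derivative_def has_derivative_at by (simp add: bounded_linear_scaleR_left)
  then show ?thesis using that c0 c(1) by blast
qed

lemma tangent_space_orthogonal_complement:
  assumes "x \<in> M" "v \<bullet> \<nu> x = 0"
  shows "v \<in> tangent_space M x"
proof -
  obtain c where "c 0 = x" "\<And>t. c t \<in> M" "(c has_vector_derivative v) (at (0::real))"
    using curve_through[OF assms] by blast
  then show ?thesis by (auto simp: tangent_space_def intro!: exI[of _ c])
qed

lemma orthogonal_tangent_imp_normal:
  assumes x: "x \<in> M" and u: "\<And>v. v \<in> tangent_space M x \<Longrightarrow> u \<bullet> v = 0"
  shows "u = (u \<bullet> \<nu> x) *\<^sub>R \<nu> x"
proof -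
  define w where "w = u - (u \<bullet> \<nu> x) *\<^sub>R \<nu> x"
  have "w \<bullet> \<nu> x = 0"
    using norm_normal[OF x] by (simp add: w_def inner_diff_left norm_eq_1)
  then have "u \<bullet> w = 0" using u tangent_space_orthogonal_complement[OF x] by blast
  with \<open>w \<bullet> \<nu> x = 0\<close> have "w \<bullet> w = 0"
    by (simp add: w_def inner_diff_left inner_diff_right inner_commute)
  then show ?thesis by (simp add: w_def)
qed

text \<open>Orthogonality to the tangent plane leaves \<open>\<plusminus>\<nu> x\<close>, and the sign is decided by which side is
  outside.\<close>

lemma outer_unit_normal_unique:
  assumes "outer_unit_normal M \<nu>'" and x: "x \<in> M"
  shows "\<nu>' x = \<nu> x"
proof -
  have n: "norm (\<nu>' x) = 1" "\<And>v. v \<in> tangent_space M x \<Longrightarrow> \<nu>' x \<bullet> v = 0"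
    using assms by (auto simp: outer_unit_normal_def)
  define a where "a = \<nu>' x \<bullet> \<nu> x"
  have a: "\<nu>' x = a *\<^sub>R \<nu> x" unfolding a_def by (rule orthogonal_tangent_imp_normal[OF x n(2)])
  then have "\<bar>a\<bar> = 1" using n(1) norm_normal[OF x] by simp
  moreover have "a \<noteq> -1"
  proof
    assume "a = -1"
    obtain \<epsilon> where \<epsilon>: "\<epsilon> > 0" "\<And>t. 0 < t \<Longrightarrow> t < \<epsilon> \<Longrightarrow> x + t *\<^sub>R \<nu> x \<in> outside M"
      using normal x unfolding outer_unit_normal_def by fastforce
    obtain \<delta> where \<delta>: "\<delta> > 0" "\<And>t. 0 < t \<Longrightarrow> t < \<delta> \<Longrightarrow> x - t *\<^sub>R \<nu>' x \<in> inside M"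
      using assms unfolding outer_unit_normal_def by fastforce
    define t where "t = min \<epsilon> \<delta> / 2"
    have "0 < t" "t < \<epsilon>" "t < \<delta>" using \<epsilon>(1) \<delta>(1) by (auto simp: t_def min_def)
    then have "x + t *\<^sub>R \<nu> x \<in> outside M \<inter> inside M"
      using \<epsilon>(2)[of t] \<delta>(2)[of t] a \<open>a = -1\<close> by simp
    then show False using inside_Int_outside by blast
  qed
  ultimately have "a = 1" by linarith
  then show ?thesis using a by simp
qed

lemma area_cball_ge:
  assumes x: "x \<in> M" and \<delta>: "0 < \<delta>" "\<delta> \<le> r"
  shows "ennreal (pi / 64 * \<delta>\<^sup>2) \<le> hausdorff2_outer (M \<inter> cball x \<delta>)"
proof -
  have "ennreal (pi / 4 * (\<delta> / 4)\<^sup>2) \<le> hausdorff2_outer (M \<inter> cball x \<delta>)"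
  proof (rule hausdorff2_outer_ge_graph[of _ "\<nu> x" x])
    fix y :: R3 assume y\<nu>: "y \<bullet> \<nu> x = 0" and "norm y \<le> 2 * (\<delta> / 4)"
    then have y: "norm y \<le> \<delta> / 2" by simp
    obtain h where h: "\<bar>h\<bar> \<le> 2 * (norm y)\<^sup>2 / r" "x + y + h *\<^sub>R \<nu> x \<in> M"
      using crossing[OF x y\<nu>] y \<delta> by auto
    have "2 * (norm y)\<^sup>2 / r = norm y * (2 * norm y / r)" by (simp add: power2_eq_square)
    also have "\<dots> \<le> norm y * 1"
      using y \<delta> r_pos by (intro mult_left_mono) (simp_all add: pos_divide_le_eq)
    finally have "\<bar>h\<bar> \<le> \<delta> / 2" using h(1) y by simp
    then have "norm (y + h *\<^sub>R \<nu> x) \<le> \<delta>"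
      using norm_triangle_ineq[of y "h *\<^sub>R \<nu> x"] y norm_normal[OF x] by simp
    then have "x + y + h *\<^sub>R \<nu> x \<in> M \<inter> cball x \<delta>"
      using h(2) by (simp add: dist_norm norm_minus_commute add.assoc flip: norm_minus_cancel[of "y + h *\<^sub>R \<nu> x"])
    then show "\<exists>h. x + y + h *\<^sub>R \<nu> x \<in> M \<inter> cball x \<delta>" by blast
  qed (use \<delta> in simp)
  then show ?thesis by (simp add: power2_eq_square)
qed

text \<open>On a tangent vector, the derivative of \<open>\<nu>\<close> is the derivative along a curve in \<open>M\<close>, to which
  the Lipschitz bound applies. Outside the differentiability points the map is zero by
  definition.\<close>

lemma weingarten_bound:
  assumes x: "x \<in> M"
  shows "norm (weingarten M \<nu> x v) \<le> norm v / r"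
proof (cases "\<nu> differentiable (at x within M)")
  case True
  define D where "D = frechet_derivative \<nu> (at x within M)"
  have D: "(\<nu> has_derivative D) (at x within M)"
    using True unfolding D_def frechet_derivative_works .
  define w where "w = v - (v \<bullet> \<nu> x) *\<^sub>R \<nu> x"
  have w: "w \<bullet> \<nu> x = 0"
    using norm_normal[OF x] by (simp add: w_def inner_diff_left norm_eq_1)
  define n where "n = (v \<bullet> \<nu> x) *\<^sub>R \<nu> x"
  have "w \<bullet> n = 0" using w by (simp add: n_def)
  then have "(norm (w + n))\<^sup>2 = (norm w)\<^sup>2 + (norm n)\<^sup>2" by (simp add: norm_add_square)
  then have "(norm w)\<^sup>2 \<le> (norm (w + n))\<^sup>2" by simp
  then have "norm w \<le> norm (w + n)" by (rule power2_le_imp_le) simp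
  also have "w + n = v" by (simp only: w_def n_def diff_add_cancel)
  finally have wv: "norm w \<le> norm v" .
  obtain c where c: "c 0 = x" "\<And>t. c t \<in> M" "(c has_vector_derivative w) (at (0::real))"
    using curve_through[OF x w] by blast
  have "(\<nu> has_derivative D) (at (c 0) within range c)"
    unfolding c(1) by (rule has_derivative_subset[OF D]) (use c in auto)
  then have "(\<nu> \<circ> c has_derivative D \<circ> (\<lambda>t. t *\<^sub>R w)) (at 0)"
    using c(3) unfolding has_vector_derivative_def by (intro diff_chain_within) auto
  moreover have "D \<circ> (\<lambda>t. t *\<^sub>R w) = (\<lambda>t. t *\<^sub>R D w)"
    using has_derivative_linear[OF D] by (auto simp: linear_cmul)
  ultimately have "(\<nu> \<circ> c has_vector_derivative D w) (at 0)"
    by (simp add: has_vector_derivative_def)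
  then have "((\<lambda>t. ((\<nu> \<circ> c) t - (\<nu> \<circ> c) 0) /\<^sub>R t) \<longlongrightarrow> D w) (at 0)"
    by (rule has_vector_derivative_imp_quotient_tendsto)
  then have lim\<nu>: "((\<lambda>t. norm (((\<nu> \<circ> c) t - (\<nu> \<circ> c) 0) /\<^sub>R t)) \<longlongrightarrow> norm (D w)) (at 0)"
    by (rule tendsto_norm)
  have "((\<lambda>t. (c t - c 0) /\<^sub>R t) \<longlongrightarrow> w) (at 0)"
    using c(3) by (rule has_vector_derivative_imp_quotient_tendsto)
  then have limc: "((\<lambda>t. norm ((c t - c 0) /\<^sub>R t) / r) \<longlongrightarrow> norm w / r) (at 0)"
    using r_pos by (intro tendsto_divide tendsto_norm tendsto_const) auto
  have "norm (((\<nu> \<circ> c) t - (\<nu> \<circ> c) 0) /\<^sub>R t) \<le> norm ((c t - c 0) /\<^sub>R t) / r" for t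
    using mult_left_mono[OF normal_lipschitz[OF c(2)[of t] c(2)[of 0]], of "\<bar>inverse t\<bar>"] by simp
  then have "norm (D w) \<le> norm w / r"
    by (intro tendsto_le[OF _ limc lim\<nu>]) auto
  also have "\<dots> \<le> norm v / r" using wv r_pos by (simp add: divide_right_mono)
  finally show ?thesis using True by (simp add: weingarten_def D_def w_def)
qed (use r_pos in \<open>simp add: weingarten_def\<close>)

lemma mean_curvature_bound:
  assumes x: "x \<in> M"
  shows "\<bar>mean_curvature M \<nu> x\<bar> \<le> 3 / r"
proof -
  have "\<bar>weingarten M \<nu> x (axis i 1) $ i\<bar> \<le> 1 / r" for i
    using order_trans[OF component_le_norm_cart weingarten_bound[OF x, of "axis i 1"]] by simp
  then have "\<bar>\<Sum>i\<in>UNIV. weingarten M \<nu> x (axis i 1) $ i\<bar> \<le> (\<Sum>i\<in>(UNIV::3 set). 1 / r)"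
    by (intro order_trans[OF sum_abs] sum_mono)
  then show ?thesis by (simp add: mean_curvature_def trace_def matrix_def)
qed

lemma gauss_curvature_bound:
  assumes x: "x \<in> M"
  shows "\<bar>gauss_curvature M \<nu> x\<bar> \<le> 6 * (1 / r + 1) ^ 3"
proof -
  define A where "A = matrix (\<lambda>v. weingarten M \<nu> x v + (v \<bullet> \<nu> x) *\<^sub>R \<nu> x)"
  define B where "B = 1 / r + 1"
  have A: "\<bar>A $ i $ j\<bar> \<le> B" for i j
  proof -
    have "\<bar>A $ i $ j\<bar> \<le> norm (weingarten M \<nu> x (axis j 1) + (axis j 1 \<bullet> \<nu> x) *\<^sub>R \<nu> x)"
      using component_le_norm_cart[of "weingarten M \<nu> x (axis j 1) + (axis j 1 \<bullet> \<nu> x) *\<^sub>R \<nu> x" i]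
      by (simp add: A_def matrix_def)
    also have "\<dots> \<le> norm (weingarten M \<nu> x (axis j 1)) + norm ((axis j 1 \<bullet> \<nu> x) *\<^sub>R \<nu> x)"
      by (rule norm_triangle_ineq)
    also have "\<dots> \<le> 1 / r + 1"
      using weingarten_bound[OF x, of "axis j 1"] Cauchy_Schwarz_ineq2[of "axis j 1" "\<nu> x"] norm_normal[OF x]
      by (intro add_mono) simp_all
    finally show ?thesis by (simp add: B_def)
  qed
  have prod: "\<bar>A $ i $ j * A $ i' $ j' * A $ i'' $ j''\<bar> \<le> B ^ 3" for i j i' j' i'' j''
    unfolding abs_mult power3_eq_cube
    by (intro mult_mono A mult_nonneg_nonneg order_trans[OF abs_ge_zero A]) auto
  \<comment> \<open>Each of the six products in the Leibniz formula is at most \<open>B\<^sup>3\<close>.\<close>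
  have "\<bar>det A\<bar> \<le> 6 * B ^ 3"
    unfolding det_3
    using prod[of 1 1 2 2 3 3] prod[of 1 2 2 3 3 1] prod[of 1 3 2 1 3 2]
      prod[of 1 1 2 3 3 2] prod[of 1 2 2 1 3 3] prod[of 1 3 2 2 3 1]
    by linarith
  then show ?thesis by (simp add: gauss_curvature_def A_def B_def)
qed

text \<open>The first variation of the squared distance to \<open>y\<close> vanishes at \<open>x\<close> in all tangent
  directions.\<close>

lemma nearest_point_normal:
  assumes x: "x \<in> M" and near: "\<And>z. z \<in> M \<Longrightarrow> norm (y - x) \<le> norm (y - z)"
  shows "y - x = ((y - x) \<bullet> \<nu> x) *\<^sub>R \<nu> x"
proof (rule orthogonal_tangent_imp_normal[OF x])
  fix v assume "v \<in> tangent_space M x"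
  then obtain c :: "real \<Rightarrow> R3" where c: "c 0 = x" "\<forall>\<^sub>F t in nhds 0. c t \<in> M" "(c has_vector_derivative v) (at 0)"
    by (auto simp: tangent_space_def)
  obtain d where d: "0 < d" "\<And>t. dist t 0 < d \<Longrightarrow> c t \<in> M"
    using c(2) unfolding eventually_nhds_metric by blast
  have "((\<lambda>t. (y - c t) \<bullet> (y - c t)) has_derivative (\<lambda>t. - 2 * ((y - x) \<bullet> v) * t)) (at 0)"
    using c(3) unfolding has_vector_derivative_def
    by (auto intro!: derivative_eq_intros simp: c(1) inner_commute algebra_simps)
  then have "DERIV (\<lambda>t. (y - c t) \<bullet> (y - c t)) 0 :> - 2 * ((y - x) \<bullet> v)"
    by (rule has_derivative_imp_has_field_derivative) simp
  moreover have "\<forall>t. \<bar>0 - t\<bar> < d \<longrightarrow> (y - c 0) \<bullet> (y - c 0) \<le> (y - c t) \<bullet> (y - c t)"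
    using near[OF d(2)] by (auto simp: c(1) dist_norm norm_le)
  ultimately have "- 2 * ((y - x) \<bullet> v) = 0"
    using d(1) by (intro DERIV_local_min)
  then show "(y - x) \<bullet> v = 0" by simp
qed

end

section \<open>Areas of nearby surfaces\<close>

text \<open>Covers of \<open>A\<close> are pulled back along \<open>g\<close>. As only fine covers matter for
  \<open>hausdorff2_outer\<close>, the expansion is needed at small scales only.\<close>

lemma hausdorff2_outer_le_local_expansion:
  fixes g :: "R3 \<Rightarrow> R3"
  assumes g: "\<And>y. y \<in> A' \<Longrightarrow> g y \<in> A" and "0 < \<theta>" "0 < \<Lambda>"
    and exp: "\<And>y z. y \<in> A' \<Longrightarrow> z \<in> A' \<Longrightarrow> norm (g y - g z) \<le> \<theta> \<Longrightarrow> norm (y - z) \<le> \<Lambda> * norm (g y - g z)"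
  shows "hausdorff2_outer A' \<le> ennreal (\<Lambda>\<^sup>2) * hausdorff2_outer A"
  unfolding hausdorff2_outer_def[of A']
proof (rule SUP_least)
  let ?w = "\<lambda>D :: R3 set. ennreal (pi * (diameter D / 2)\<^sup>2)"
  fix \<delta> :: real assume "\<delta> \<in> {0<..}"
  then have "0 < \<delta>" by simp
  define \<delta>' where "\<delta>' = min \<theta> (\<delta> / \<Lambda>)"
  have \<delta>': "0 < \<delta>'" "\<delta>' \<le> \<theta>" "\<Lambda> * \<delta>' \<le> \<delta>"
    using \<open>0 < \<delta>\<close> \<open>0 < \<theta>\<close> \<open>0 < \<Lambda>\<close> by (auto simp: \<delta>'_def min_def field_simps)
  have "ennreal (1 / \<Lambda>\<^sup>2) * hausdorff2_pre \<delta> A' \<le> hausdorff2_pre \<delta>' A"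
    unfolding hausdorff2_pre_def[of \<delta>' A]
  proof (rule INF_greatest, clarify)
    fix C :: "nat \<Rightarrow> R3 set"
    assume C: "A \<subseteq> (\<Union>i. C i)" "\<forall>i. bounded (C i) \<and> diameter (C i) \<le> \<delta>'"
    define C' where "C' i = {y \<in> A'. g y \<in> C i}" for i
    have dist: "norm (y - z) \<le> \<Lambda> * diameter (C i)" if "y \<in> C' i" "z \<in> C' i" for y z i
    proof -
      have n: "norm (g y - g z) \<le> diameter (C i)"
        using diameter_bounded_bound[of "C i" "g y" "g z"] that C(2) by (auto simp: C'_def dist_norm)
      also have "\<dots> \<le> \<theta>" using C(2) \<delta>'(2) order_trans by blast
      finally have "norm (y - z) \<le> \<Lambda> * norm (g y - g z)"
        using that by (intro exp) (auto simp: C'_def)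
      also have "\<dots> \<le> \<Lambda> * diameter (C i)" using n \<open>0 < \<Lambda>\<close> by (simp add: mult_left_mono)
      finally show ?thesis .
    qed
    have d0: "0 \<le> diameter (C i)" for i using C(2) by (simp add: diameter_ge_0)
    have diam: "diameter (C' i) \<le> \<Lambda> * diameter (C i)" for i
      using dist d0 \<open>0 < \<Lambda>\<close> by (intro diameter_le) auto
    have bnd: "bounded (C' i)" for i
      unfolding bounded_two_points using dist by (auto simp: dist_norm)
    have "diameter (C' i) \<le> \<delta>" for i
    proof -
      have "\<Lambda> * diameter (C i) \<le> \<Lambda> * \<delta>'" using C(2) \<open>0 < \<Lambda>\<close> by (intro mult_left_mono) auto
      then show ?thesis using diam[of i] \<delta>'(3) by linarith
    qed
    moreover have "A' \<subseteq> (\<Union>i. C' i)" using g C(1) by (fastforce simp: C'_def)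
    ultimately have "hausdorff2_pre \<delta> A' \<le> (\<Sum>i. ?w (C' i))"
      unfolding hausdorff2_pre_def using bnd by (intro INF_lower) auto
    also have "\<dots> \<le> (\<Sum>i. ennreal (\<Lambda>\<^sup>2) * ?w (C i))"
    proof (intro suminf_le)
      fix i
      have "(diameter (C' i) / 2)\<^sup>2 \<le> (\<Lambda> * diameter (C i) / 2)\<^sup>2"
        using diam[of i] bnd[of i] by (intro power_mono) (auto simp: diameter_ge_0)
      then have "pi * (diameter (C' i) / 2)\<^sup>2 \<le> \<Lambda>\<^sup>2 * (pi * (diameter (C i) / 2)\<^sup>2)"
        by (simp add: power_mult_distrib power_divide mult.left_commute)
      then show "?w (C' i) \<le> ennreal (\<Lambda>\<^sup>2) * ?w (C i)"
        by (simp add: ennreal_leI flip: ennreal_mult)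
    qed auto
    also have "\<dots> = ennreal (\<Lambda>\<^sup>2) * (\<Sum>i. ?w (C i))" by simp
    finally have "ennreal (1 / \<Lambda>\<^sup>2) * hausdorff2_pre \<delta> A' \<le> ennreal (1 / \<Lambda>\<^sup>2) * (ennreal (\<Lambda>\<^sup>2) * (\<Sum>i. ?w (C i)))"
      by (rule mult_left_mono) simp
    also have "\<dots> = (\<Sum>i. ?w (C i))"
      using \<open>0 < \<Lambda>\<close> by (simp add: mult.assoc[symmetric] del: ennreal_suminf_cmult flip: ennreal_mult)
    finally show "ennreal (1 / \<Lambda>\<^sup>2) * hausdorff2_pre \<delta> A' \<le> (\<Sum>i. ?w (C i))" .
  qed
  also have "\<dots> \<le> hausdorff2_outer A"
    unfolding hausdorff2_outer_def using \<delta>'(1) by (intro SUP_upper) auto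
  finally have "ennreal (\<Lambda>\<^sup>2) * (ennreal (1 / \<Lambda>\<^sup>2) * hausdorff2_pre \<delta> A') \<le> ennreal (\<Lambda>\<^sup>2) * hausdorff2_outer A"
    by (rule mult_left_mono) simp
  then show "hausdorff2_pre \<delta> A' \<le> ennreal (\<Lambda>\<^sup>2) * hausdorff2_outer A"
    using \<open>0 < \<Lambda>\<close> by (simp add: mult.assoc[symmetric] flip: ennreal_mult)
qed

text \<open>Let \<open>y\<^sub>i = x\<^sub>i + t\<^sub>i \<nu> x\<^sub>i\<close>. The difference \<open>D = y\<^sub>1 - y\<^sub>2\<close> consists of \<open>d = x\<^sub>1 - x\<^sub>2\<close>, of
  \<open>t\<^sub>2 (\<nu> x\<^sub>1 - \<nu> x\<^sub>2)\<close>, which is small against \<open>d\<close> because \<open>\<nu>\<close> is Lipschitz, and of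
  \<open>(t\<^sub>1 - t\<^sub>2) \<nu> x\<^sub>1\<close>. For the last term, \<open>t\<^sub>1 - t\<^sub>2\<close> is read off from the component of \<open>D\<close> in direction
  \<open>\<nu> x\<^sub>1\<close>. That direction is close to the normal of \<open>M'\<close> at \<open>y\<^sub>1\<close>, and the normal component of a
  short chord is quadratic in its length; so the term is small against \<open>D\<close> and \<open>d\<close>. Here it is
  essential that the tilt between the two normals is small.\<close>

lemma normal_foot_expansion:
  assumes "ball_surface M \<nu> r" "ball_surface M' \<nu>' r"
    and x: "x\<^sub>1 \<in> M" "x\<^sub>2 \<in> M" and y: "x\<^sub>1 + t\<^sub>1 *\<^sub>R \<nu> x\<^sub>1 \<in> M'" "x\<^sub>2 + t\<^sub>2 *\<^sub>R \<nu> x\<^sub>2 \<in> M'"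
    and t: "\<bar>t\<^sub>1\<bar> \<le> \<theta>" "\<bar>t\<^sub>2\<bar> \<le> \<theta>"
    and tilt: "norm (\<nu> x\<^sub>1 - \<nu>' (x\<^sub>1 + t\<^sub>1 *\<^sub>R \<nu> x\<^sub>1)) \<le> \<theta>"
    and close: "norm (x\<^sub>1 - x\<^sub>2) \<le> \<theta>"
    and \<theta>: "\<theta> + 3 * \<theta> / r \<le> s" and s: "s \<le> 1 / 2"
  shows "norm (x\<^sub>1 + t\<^sub>1 *\<^sub>R \<nu> x\<^sub>1 - (x\<^sub>2 + t\<^sub>2 *\<^sub>R \<nu> x\<^sub>2)) \<le> (1 + 4 * s) * norm (x\<^sub>1 - x\<^sub>2)"
proof -
  interpret S: ball_surface M \<nu> r by fact
  interpret S': ball_surface M' \<nu>' r by fact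
  define D where "D = x\<^sub>1 + t\<^sub>1 *\<^sub>R \<nu> x\<^sub>1 - (x\<^sub>2 + t\<^sub>2 *\<^sub>R \<nu> x\<^sub>2)"
  define d where "d = x\<^sub>1 - x\<^sub>2"
  define E where "E = \<nu> x\<^sub>1 - \<nu> x\<^sub>2"
  have r: "0 < r" by (rule S.r_pos)
  have \<theta>0: "0 \<le> \<theta>" using t(1) by linarith
  have n1: "norm (\<nu> x\<^sub>1) = 1" "norm (\<nu> x\<^sub>2) = 1" using S.norm_normal x by auto
  have D: "D = d + (t\<^sub>1 - t\<^sub>2) *\<^sub>R \<nu> x\<^sub>1 + t\<^sub>2 *\<^sub>R E"
    by (simp add: D_def d_def E_def algebra_simps)
  have "norm E \<le> norm d / r"
    unfolding E_def d_def by (rule S.normal_lipschitz[OF x])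
  then have tE: "norm (t\<^sub>2 *\<^sub>R E) \<le> \<theta> * (norm d / r)"
    unfolding norm_scaleR by (intro mult_mono t(2) \<theta>0 norm_ge_zero)
  have d_small: "(norm d)\<^sup>2 / (2 * r) \<le> \<theta> * norm d / (2 * r)"
    unfolding power2_eq_square
    by (intro divide_right_mono mult_right_mono) (use close r in \<open>simp_all add: d_def\<close>)
  have "D = d + t\<^sub>1 *\<^sub>R \<nu> x\<^sub>1 + (- t\<^sub>2) *\<^sub>R \<nu> x\<^sub>2" by (simp add: D_def d_def)
  then have "norm D \<le> norm d + \<bar>t\<^sub>1\<bar> + \<bar>t\<^sub>2\<bar>"
    using norm_triangle_ineq[of "d + t\<^sub>1 *\<^sub>R \<nu> x\<^sub>1" "(- t\<^sub>2) *\<^sub>R \<nu> x\<^sub>2"] norm_triangle_ineq[of d "t\<^sub>1 *\<^sub>R \<nu> x\<^sub>1"] n1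
    by simp
  then have "norm D \<le> 3 * \<theta>" using t close by (simp add: d_def)
  then have D_small: "(norm D)\<^sup>2 / (2 * r) \<le> 3 * \<theta> * norm D / (2 * r)"
    unfolding power2_eq_square using r by (intro divide_right_mono mult_right_mono) simp_all
  have D\<nu>: "\<bar>D \<bullet> \<nu> x\<^sub>1\<bar> \<le> 3 * \<theta> * norm D / (2 * r) + \<theta> * norm D"
  proof -
    let ?n = "\<nu>' (x\<^sub>1 + t\<^sub>1 *\<^sub>R \<nu> x\<^sub>1)"
    have "\<bar>D \<bullet> ?n\<bar> \<le> (norm D)\<^sup>2 / (2 * r)"
    proof -
      have "x\<^sub>2 + t\<^sub>2 *\<^sub>R \<nu> x\<^sub>2 - (x\<^sub>1 + t\<^sub>1 *\<^sub>R \<nu> x\<^sub>1) = - D" by (simp add: D_def)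
      then show ?thesis using S'.normal_component_quadratic[OF y] by simp
    qed
    moreover have "\<bar>D \<bullet> (\<nu> x\<^sub>1 - ?n)\<bar> \<le> norm D * \<theta>"
      by (rule order_trans[OF Cauchy_Schwarz_ineq2]) (simp add: mult_left_mono tilt)
    moreover have "D \<bullet> \<nu> x\<^sub>1 = D \<bullet> ?n + D \<bullet> (\<nu> x\<^sub>1 - ?n)" by (simp add: inner_diff_right)
    ultimately show ?thesis using D_small by (simp add: mult.commute)
  qed
  have d\<nu>: "\<bar>d \<bullet> \<nu> x\<^sub>1\<bar> \<le> \<theta> * norm d / (2 * r)"
  proof -
    have "x\<^sub>2 - x\<^sub>1 = - d" by (simp add: d_def)
    then show ?thesis using S.normal_component_quadratic[OF x] d_small by simp
  qed
  have E\<nu>: "\<bar>(t\<^sub>2 *\<^sub>R E) \<bullet> \<nu> x\<^sub>1\<bar> \<le> \<theta> * (norm d / r)"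
    using order_trans[OF Cauchy_Schwarz_ineq2, of "t\<^sub>2 *\<^sub>R E" "\<nu> x\<^sub>1"] n1 tE by simp
  have "t\<^sub>1 - t\<^sub>2 = D \<bullet> \<nu> x\<^sub>1 - d \<bullet> \<nu> x\<^sub>1 - (t\<^sub>2 *\<^sub>R E) \<bullet> \<nu> x\<^sub>1"
    using n1 unfolding D by (simp add: inner_add_left norm_eq_1)
  then have "\<bar>t\<^sub>1 - t\<^sub>2\<bar> \<le> 3 * \<theta> * norm D / (2 * r) + \<theta> * norm D + \<theta> * norm d / (2 * r) + \<theta> * (norm d / r)"
    using D\<nu> d\<nu> E\<nu> by linarith
  moreover have "norm D \<le> norm d + \<bar>t\<^sub>1 - t\<^sub>2\<bar> + norm (t\<^sub>2 *\<^sub>R E)"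
    unfolding D
    using norm_triangle_ineq[of "d + (t\<^sub>1 - t\<^sub>2) *\<^sub>R \<nu> x\<^sub>1" "t\<^sub>2 *\<^sub>R E"] norm_triangle_ineq[of d "(t\<^sub>1 - t\<^sub>2) *\<^sub>R \<nu> x\<^sub>1"] n1
    by simp
  ultimately have "norm D \<le> norm d + 3 * \<theta> * norm D / (2 * r) + \<theta> * norm D + \<theta> * norm d / (2 * r)
      + 2 * (\<theta> * (norm d / r))"
    using tE by linarith
  also have "\<dots> = norm d + (\<theta> + 3 / 2 * \<theta> / r) * norm D + (5 / 2 * \<theta> / r) * norm d"
    using r by (simp add: field_simps)
  also have "\<dots> \<le> norm d + s * norm D + s * norm d"
  proof -
    have "0 \<le> \<theta> / r" using \<theta>0 r by simp
    then have "\<theta> + 3 / 2 * \<theta> / r \<le> s" "5 / 2 * \<theta> / r \<le> s"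
      using \<theta> \<theta>0 by auto
    then show ?thesis by (intro add_mono mult_right_mono) auto
  qed
  finally have "(1 - s) * norm D \<le> (1 + s) * norm d" by (simp add: algebra_simps)
  also have "\<dots> \<le> (1 - s) * (1 + 4 * s) * norm d"
  proof (intro mult_right_mono)
    have "0 \<le> s" using \<theta> \<theta>0 r by (smt (verit) divide_nonneg_pos)
    then have "s * (2 * s) \<le> s * 1" using s by (intro mult_left_mono) auto
    then show "1 + s \<le> (1 - s) * (1 + 4 * s)" by (simp add: algebra_simps)
  qed simp
  finally have "(1 - s) * norm D \<le> (1 - s) * ((1 + 4 * s) * norm d)" by (simp add: mult.assoc)
  then show ?thesis using s by (simp add: D_def d_def)
qed

text \<open>The map \<open>g\<close> is a nearest point projection to \<open>M\<close>. The point \<open>x\<close> provided by the hypothesis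
  need not be nearest, but the nearest point is within \<open>2 \<epsilon>\<close> of it, which costs \<open>2 \<epsilon> / r\<close> in the tilt
  of the normals.\<close>

lemma area_comparison:
  assumes "ball_surface M \<nu> r" "ball_surface M' \<nu>' r"
    and near: "\<And>y. y \<in> M' \<Longrightarrow> \<exists>x\<in>M. norm (x - y) \<le> \<epsilon> \<and> norm (\<nu> x - \<nu>' y) \<le> \<epsilon>"
    and \<epsilon>: "0 < \<epsilon>" and \<theta>: "\<epsilon> * (1 + 2 / r) * (1 + 3 / r) \<le> s" and s: "s \<le> 1 / 2"
  shows "hausdorff2_outer M' \<le> ennreal ((1 + 4 * s)\<^sup>2) * hausdorff2_outer M"
proof -
  interpret S: ball_surface M \<nu> r by fact
  interpret S': ball_surface M' \<nu>' r by fact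
  have r: "0 < r" by (rule S.r_pos)
  define \<theta> where "\<theta> = \<epsilon> * (1 + 2 / r)"
  have "\<epsilon> * 1 \<le> \<theta>" unfolding \<theta>_def using \<epsilon> r by (intro mult_left_mono) auto
  then have \<theta>0: "0 < \<theta>" "\<epsilon> \<le> \<theta>" using \<epsilon> by simp_all
  have \<theta>s: "\<theta> + 3 * \<theta> / r \<le> s" using \<theta> unfolding \<theta>_def[symmetric] by (simp add: distrib_left mult.commute)
  then have s0: "0 < s" using \<theta>0 r by (smt (verit) divide_nonneg_pos)
  have "\<exists>x t. x \<in> M \<and> y = x + t *\<^sub>R \<nu> x \<and> \<bar>t\<bar> \<le> \<theta> \<and> norm (\<nu> x - \<nu>' y) \<le> \<theta>" if y: "y \<in> M'" for y
  proof -
    obtain z where z: "z \<in> M" "norm (z - y) \<le> \<epsilon>" "norm (\<nu> z - \<nu>' y) \<le> \<epsilon>"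
      using near[OF y] by blast
    obtain x where x: "x \<in> M" "\<And>w. w \<in> M \<Longrightarrow> dist y x \<le> dist y w"
      using distance_attains_inf[OF compact_imp_closed[OF S.compact], of y] z(1) by blast
    define t where "t = (y - x) \<bullet> \<nu> x"
    have yx: "y - x = t *\<^sub>R \<nu> x"
      unfolding t_def using x by (intro S.nearest_point_normal) (auto simp: dist_norm)
    have d: "norm (y - x) \<le> \<epsilon>"
      using x(2)[OF z(1)] z(2) by (simp add: dist_norm norm_minus_commute)
    then have "\<bar>t\<bar> \<le> \<epsilon>" unfolding yx using S.norm_normal[OF x(1)] by simp
    have "norm (x - z) \<le> 2 * \<epsilon>"
      using norm_triangle_ineq[of "x - y" "y - z"] d z(2) by (simp add: norm_minus_commute)
    then have "norm (\<nu> x - \<nu> z) \<le> 2 * \<epsilon> / r"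
      using S.normal_lipschitz[OF x(1) z(1)] divide_right_mono[of "norm (x - z)" "2 * \<epsilon>" r] r by linarith
    then have "norm (\<nu> x - \<nu>' y) \<le> \<theta>"
      using norm_triangle_ineq[of "\<nu> x - \<nu> z" "\<nu> z - \<nu>' y"] z(3) by (simp add: \<theta>_def algebra_simps)
    then show ?thesis
      using x(1) yx \<open>\<bar>t\<bar> \<le> \<epsilon>\<close> \<theta>0(2) by (intro exI[of _ x] exI[of _ t]) (auto simp: algebra_simps)
  qed
  then obtain g t where g: "\<And>y. y \<in> M' \<Longrightarrow> g y \<in> M \<and> y = g y + t y *\<^sub>R \<nu> (g y) \<and> \<bar>t y\<bar> \<le> \<theta> \<and> norm (\<nu> (g y) - \<nu>' y) \<le> \<theta>"
    by metis
  show ?thesis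
  proof (rule hausdorff2_outer_le_local_expansion[of M' g M \<theta> "1 + 4 * s"])
    fix y z assume yz: "y \<in> M'" "z \<in> M'" "norm (g y - g z) \<le> \<theta>"
    have gy: "g y \<in> M" "g y + t y *\<^sub>R \<nu> (g y) = y" "\<bar>t y\<bar> \<le> \<theta>" "norm (\<nu> (g y) - \<nu>' y) \<le> \<theta>"
      and gz: "g z \<in> M" "g z + t z *\<^sub>R \<nu> (g z) = z" "\<bar>t z\<bar> \<le> \<theta>"
      using g[OF yz(1)] g[OF yz(2)] by auto
    show "norm (y - z) \<le> (1 + 4 * s) * norm (g y - g z)"
      using normal_foot_expansion[OF assms(1,2) gy(1) gz(1), of "t y" "t z" \<theta> s] gy gz yz \<theta>s s by simp
  qed (use g \<theta>0 s0 in auto)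
qed

section \<open>Varifolds and their energy\<close>

lemma sets_varifold [simp, measurable_cong]: "sets (varifold M \<nu> k) = sets borel"
  and space_varifold [simp]: "space (varifold M \<nu> k) = UNIV"
  by (simp_all add: varifold_def space_scale_measure)

text \<open>If the image measure failed to be countably additive, \<open>distr\<close> would be zero by definition;
  otherwise it can be evaluated on cylinders, whose preimages do not depend on \<open>\<nu>\<close>. This covers the
  arbitrary representations \<open>V = varifold M \<nu> k\<close> in the definition of \<open>CH_energy\<close>.\<close>

lemma emeasure_varifold_times_UNIV:
  assumes "closed M" and nz: "emeasure (varifold M \<nu> k) UNIV \<noteq> 0" and B: "B \<in> sets borel"
  shows "emeasure (varifold M \<nu> k) (B \<times> UNIV) = of_nat k * emeasure hausdorff2 (B \<inter> M)"
proof -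
  let ?f = "\<lambda>x. (x, \<nu> x)" and ?R = "restrict_space hausdorff2 M"
  let ?\<mu> = "\<lambda>A. emeasure ?R (?f -` A \<inter> space ?R)"
  have sig: "sigma_sets UNIV (sets borel) = sets (borel :: (R3 \<times> R3) measure)"
    using sets.sigma_sets_eq[of "borel :: (R3 \<times> R3) measure"] by simp
  have distr: "emeasure (distr ?R borel ?f) A = (if A \<in> sets borel \<and> measure_space UNIV (sets borel) ?\<mu> then ?\<mu> A else 0)" for A
    unfolding distr_def emeasure_measure_of_conv by (simp add: sig)
  have ms: "measure_space UNIV (sets borel) ?\<mu>"
    using nz by (auto simp: varifold_def distr split: if_splits)
  have M: "M \<in> sets borel" using \<open>closed M\<close> by simp
  have "B \<times> UNIV \<in> sets (borel :: (R3 \<times> R3) measure)"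
    using B by (simp add: borel_prod[symmetric])
  then have "emeasure (distr ?R borel ?f) (B \<times> UNIV) = ?\<mu> (B \<times> UNIV)"
    using ms by (simp add: distr)
  also have "?f -` (B \<times> UNIV) \<inter> space ?R = B \<inter> M"
    by (auto simp: space_restrict_space)
  also have "emeasure ?R (B \<inter> M) = emeasure hausdorff2 (B \<inter> M)"
    using M by (intro emeasure_restrict_space) auto
  finally show ?thesis by (simp add: varifold_def)
qed

context ball_surface
begin

lemma closed: "closed M" by (rule compact_imp_closed[OF compact])

lemma continuous_on_normal: "continuous_on M \<nu>"
proof (rule lipschitz_on_continuous_on)
  show "(1 / r)-lipschitz_on M \<nu>"
    using normal_lipschitz r_pos by (intro lipschitz_onI) (simp_all add: dist_norm)
qed

lemma emeasure_varifold:
  assumes B: "B \<in> sets borel"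
  shows "emeasure (varifold M \<nu> k) B = of_nat k * emeasure hausdorff2 {x \<in> M. (x, \<nu> x) \<in> B}"
proof -
  let ?f = "\<lambda>x. (x, \<nu> x)" and ?R = "restrict_space hausdorff2 M"
  have M: "M \<in> sets borel" using closed by simp
  have "sets ?R = sets (restrict_space borel M)"
    by (rule sets_restrict_space_cong) simp
  moreover have "?f \<in> borel_measurable (restrict_space borel M)"
    by (intro borel_measurable_continuous_on_restrict continuous_intros continuous_on_normal)
  ultimately have f: "?f \<in> borel_measurable ?R"
    using measurable_cong_sets by blast
  have "emeasure (distr ?R borel ?f) B = emeasure ?R (?f -` B \<inter> space ?R)"
    by (rule emeasure_distr[OF f]) (simp add: B)
  also have "?f -` B \<inter> space ?R = {x \<in> M. (x, \<nu> x) \<in> B}"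
    by (auto simp: space_restrict_space)
  also have "emeasure ?R {x \<in> M. (x, \<nu> x) \<in> B} = emeasure hausdorff2 {x \<in> M. (x, \<nu> x) \<in> B}"
    using M by (intro emeasure_restrict_space) auto
  finally show ?thesis by (simp add: varifold_def)
qed

lemma mass_varifold: "emeasure (varifold M \<nu> k) UNIV = of_nat k * emeasure hausdorff2 M"
  by (simp add: emeasure_varifold)

text \<open>Both surfaces are the support of the common mass, by \<open>hausdorff2_outer_ball_pos\<close>; then the total
  mass determines the multiplicity, and the surface alone determines its outer normal.\<close>

lemma varifold_determines:
  assumes M': "compact M'" and \<nu>': "outer_unit_normal M' \<nu>'"
    and eq: "varifold M \<nu> k = varifold M' \<nu>' k'"
    and mass: "0 < of_nat k * emeasure hausdorff2 M" "of_nat k * emeasure hausdorff2 M < top"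
  shows "M' = M" "k' = k" "\<And>x. x \<in> M \<Longrightarrow> \<nu>' x = \<nu> x"
proof -
  have closed': "closed M'" by (rule compact_imp_closed[OF M'])
  have nz: "emeasure (varifold M \<nu> k) UNIV \<noteq> 0"
    unfolding mass_varifold using mass(1) by (rule less_imp_neq[symmetric])
  have mass_eq: "of_nat k * emeasure hausdorff2 (B \<inter> M) = of_nat k' * emeasure hausdorff2 (B \<inter> M')"
    if "B \<in> sets borel" for B
    using emeasure_varifold_times_UNIV[OF closed nz that] emeasure_varifold_times_UNIV[OF closed' nz[unfolded eq] that]
    unfolding eq by (rule trans[OF sym])
  have kk': "0 < k" "0 < k'"
    using mass(1) mass_eq[of UNIV] by (cases "k = 0"; cases "k' = 0"; simp)+
  have sub: "N \<subseteq> N'" if N: "closed N" "outer_unit_normal N n" "closed N'" and j: "0 < j"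
    and eq: "\<And>B. B \<in> sets borel \<Longrightarrow> of_nat j * emeasure hausdorff2 (B \<inter> N) = of_nat j' * emeasure hausdorff2 (B \<inter> N')"
    for N N' n and j j' :: nat
  proof
    fix x assume x: "x \<in> N"
    show "x \<in> N'"
    proof (rule ccontr)
      assume "x \<notin> N'"
      then obtain \<epsilon> where \<epsilon>: "\<epsilon> > 0" "ball x \<epsilon> \<subseteq> - N'"
        using \<open>closed N'\<close> open_contains_ball[of "- N'"] by (auto simp: open_Compl)
      then have "ball x \<epsilon> \<inter> N' = {}" by blast
      then have "of_nat j * emeasure hausdorff2 (ball x \<epsilon> \<inter> N) = 0"
        using eq[of "ball x \<epsilon>"] by simp
      then have "emeasure hausdorff2 (ball x \<epsilon> \<inter> N) = 0" using j by simp
      moreover have "0 < hausdorff2_outer (N \<inter> ball x \<epsilon>)"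
        by (rule hausdorff2_outer_ball_pos[OF N(1,2) x \<epsilon>(1)])
      ultimately show False using N(1) by (simp add: emeasure_hausdorff2 Int_commute)
    qed
  qed
  have "M \<subseteq> M'" by (rule sub[OF closed normal closed' kk'(1) mass_eq])
  moreover have "M' \<subseteq> M" by (rule sub[OF closed' \<nu>' closed kk'(2) mass_eq[symmetric]])
  ultimately show M'M: "M' = M" by blast
  have pos_fin: "emeasure hausdorff2 M \<noteq> 0" "emeasure hausdorff2 M \<noteq> top"
    using mass kk'(1) by (auto simp: ennreal_mult_top)
  have "of_nat k * emeasure hausdorff2 M = of_nat k' * emeasure hausdorff2 M"
    using mass_eq[of UNIV] by (simp add: M'M)
  then have "real k * enn2real (emeasure hausdorff2 M) = real k' * enn2real (emeasure hausdorff2 M)"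
    by (metis enn2real_mult enn2real_of_nat)
  moreover have "enn2real (emeasure hausdorff2 M) \<noteq> 0"
    using pos_fin by (simp add: enn2real_eq_0_iff)
  ultimately have "real k = real k'" by simp
  then show "k' = k" by simp
  show "\<nu>' x = \<nu> x" if "x \<in> M" for x
    using outer_unit_normal_unique[OF \<nu>'[unfolded M'M] that] .
qed

end

lemma CH_density_cong:
  assumes "\<And>x. x \<in> M \<Longrightarrow> \<nu>' x = \<nu> x" "x \<in> M"
  shows "CH_density \<beta> \<gamma> H M \<nu>' x = CH_density \<beta> \<gamma> H M \<nu> x"
proof -
  have "(\<nu>' has_derivative D) (at x within M) \<longleftrightarrow> (\<nu> has_derivative D) (at x within M)" for D
    by (rule iffI; erule has_derivative_transform[rotated 2]) (use assms in auto)
  then have "weingarten M \<nu>' x = weingarten M \<nu> x"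
    using assms by (simp add: weingarten_def differentiable_def frechet_derivative_def fun_eq_iff)
  then show ?thesis
    using assms by (simp add: CH_density_def mean_curvature_def gauss_curvature_def)
qed

context ball_surface
begin

lemma CH_energy_varifold:
  assumes M: "C11_closed_surface M" and k: "k \<ge> 1"
    and mass: "0 < of_nat k * emeasure hausdorff2 M" "of_nat k * emeasure hausdorff2 M < top"
  shows "CH_energy \<beta> \<gamma> H (varifold M \<nu> k) =
    (if set_integrable hausdorff2 M (CH_density \<beta> \<gamma> H M \<nu>)
     then ereal (real k * (LINT x:M|hausdorff2. CH_density \<beta> \<gamma> H M \<nu> x)) else \<infinity>)"
  unfolding CH_energy_def
proof (rule the_equality)
  show "\<exists>M' \<nu>' k'. C11_closed_surface M' \<and> outer_unit_normal M' \<nu>' \<and> 1 \<le> k' \<and>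
      varifold M \<nu> k = varifold M' \<nu>' k' \<and>
      (if set_integrable hausdorff2 M (CH_density \<beta> \<gamma> H M \<nu>)
       then ereal (real k * (LINT x:M|hausdorff2. CH_density \<beta> \<gamma> H M \<nu> x)) else \<infinity>) =
      (if set_integrable hausdorff2 M' (CH_density \<beta> \<gamma> H M' \<nu>')
       then ereal (real k' * (LINT x:M'|hausdorff2. CH_density \<beta> \<gamma> H M' \<nu>' x)) else \<infinity>)"
    using M normal k by blast
next
  fix E
  assume "\<exists>M' \<nu>' k'. C11_closed_surface M' \<and> outer_unit_normal M' \<nu>' \<and> 1 \<le> k' \<and>
      varifold M \<nu> k = varifold M' \<nu>' k' \<and>
      E = (if set_integrable hausdorff2 M' (CH_density \<beta> \<gamma> H M' \<nu>')
       then ereal (real k' * (LINT x:M'|hausdorff2. CH_density \<beta> \<gamma> H M' \<nu>' x)) else \<infinity>)"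
  then obtain M' \<nu>' k' where M': "C11_closed_surface M'" and \<nu>': "outer_unit_normal M' \<nu>'"
    and eq: "varifold M \<nu> k = varifold M' \<nu>' k'"
    and E: "E = (if set_integrable hausdorff2 M' (CH_density \<beta> \<gamma> H M' \<nu>')
       then ereal (real k' * (LINT x:M'|hausdorff2. CH_density \<beta> \<gamma> H M' \<nu>' x)) else \<infinity>)"
    by blast
  have "compact M'"
    using M' by (auto simp: C11_closed_surface_def smooth_closed_surface_def C11_embedding_def
      intro: compact_continuous_image differentiable_imp_continuous_on)
  note det = varifold_determines[OF this \<nu>' eq mass]
  have dens: "CH_density \<beta> \<gamma> H M \<nu>' x = CH_density \<beta> \<gamma> H M \<nu> x" if "x \<in> M" for x
    using det(3) that by (rule CH_density_cong)
  have "set_integrable hausdorff2 M (CH_density \<beta> \<gamma> H M \<nu>') = set_integrable hausdorff2 M (CH_density \<beta> \<gamma> H M \<nu>)"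
    using dens by (intro set_integrable_cong) auto
  moreover have "(LINT x:M|hausdorff2. CH_density \<beta> \<gamma> H M \<nu>' x) = (LINT x:M|hausdorff2. CH_density \<beta> \<gamma> H M \<nu> x)"
    using dens closed by (intro set_lebesgue_integral_cong) auto
  ultimately show "E = (if set_integrable hausdorff2 M (CH_density \<beta> \<gamma> H M \<nu>)
     then ereal (real k * (LINT x:M|hausdorff2. CH_density \<beta> \<gamma> H M \<nu> x)) else \<infinity>)"
    using E by (simp add: det(1,2))
qed

lemma CH_density_bound:
  assumes "x \<in> M"
  shows "\<bar>CH_density \<beta> \<gamma> H M \<nu> x\<bar> \<le> \<bar>\<beta>\<bar> / 2 * (3 / r + \<bar>H\<bar>)\<^sup>2 + \<bar>\<gamma>\<bar> * (6 * (1 / r + 1) ^ 3)"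
proof -
  have "\<bar>mean_curvature M \<nu> x - H\<bar> \<le> \<bar>3 / r + \<bar>H\<bar>\<bar>"
    using mean_curvature_bound[OF assms] by linarith
  then have "(mean_curvature M \<nu> x - H)\<^sup>2 \<le> (3 / r + \<bar>H\<bar>)\<^sup>2"
    by (simp only: abs_le_square_iff)
  then have "\<bar>\<beta> / 2 * (mean_curvature M \<nu> x - H)\<^sup>2\<bar> \<le> \<bar>\<beta>\<bar> / 2 * (3 / r + \<bar>H\<bar>)\<^sup>2"
    by (simp add: abs_mult mult_left_mono)
  moreover have "\<bar>\<gamma> * gauss_curvature M \<nu> x\<bar> \<le> \<bar>\<gamma>\<bar> * (6 * (1 / r + 1) ^ 3)"
    unfolding abs_mult by (intro mult_left_mono gauss_curvature_bound[OF assms]) simp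
  ultimately show ?thesis unfolding CH_density_def by linarith
qed

text \<open>The density is bounded, so that its integral is at least minus this bound times the mass. A
  density that fails to be integrable has energy \<open>\<infinity>\<close>.\<close>

lemma CH_energy_varifold_ge:
  assumes M: "C11_closed_surface M" and k: "k \<ge> 1" and m: "0 < m"
    and mass: "of_nat k * emeasure hausdorff2 M = ennreal m"
  shows "ereal (- m * (\<bar>\<beta>\<bar> / 2 * (3 / r + \<bar>H\<bar>)\<^sup>2 + \<bar>\<gamma>\<bar> * (6 * (1 / r + 1) ^ 3)))
    \<le> CH_energy \<beta> \<gamma> H (varifold M \<nu> k)"
proof -
  define C where "C = \<bar>\<beta>\<bar> / 2 * (3 / r + \<bar>H\<bar>)\<^sup>2 + \<bar>\<gamma>\<bar> * (6 * (1 / r + 1) ^ 3)"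
  have MB: "M \<in> sets hausdorff2" using closed by simp
  have fin: "emeasure hausdorff2 M < top"
    using mass k by (cases "emeasure hausdorff2 M = top") (auto simp: ennreal_mult_top less_top)
  have km: "real k * measure hausdorff2 M = m"
  proof -
    have "enn2real (of_nat k * emeasure hausdorff2 M) = m" using mass m by simp
    then show ?thesis by (simp add: enn2real_mult measure_def)
  qed
  have "ereal (- m * C) \<le> ereal (real k * (LINT x:M|hausdorff2. CH_density \<beta> \<gamma> H M \<nu> x))"
    if int: "set_integrable hausdorff2 M (CH_density \<beta> \<gamma> H M \<nu>)"
  proof -
    have "(LINT x:M|hausdorff2. - C) \<le> (LINT x:M|hausdorff2. CH_density \<beta> \<gamma> H M \<nu> x)"
    proof (rule set_integral_mono[OF _ int])
      show "set_integrable hausdorff2 M (\<lambda>x. - C)"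
        unfolding set_integrable_def using MB fin by (intro integrable_scaleR_left) (simp add: integrable_indicator_iff)
      show "- C \<le> CH_density \<beta> \<gamma> H M \<nu> x" if "x \<in> M" for x
        using CH_density_bound[OF that, of \<beta> \<gamma> H] unfolding C_def by linarith
    qed
    moreover have "(LINT x:M|hausdorff2. - C) = - C * measure hausdorff2 M"
      using MB by (simp add: set_lebesgue_integral_def)
    ultimately have "real k * (- C * measure hausdorff2 M) \<le> real k * (LINT x:M|hausdorff2. CH_density \<beta> \<gamma> H M \<nu> x)"
      by (intro mult_left_mono) auto
    moreover have "real k * (- C * measure hausdorff2 M) = - (real k * measure hausdorff2 M) * C" by simp
    moreover note km
    ultimately show ?thesis by (simp only: ereal_less_eq)
  qed
  then show ?thesis
    using CH_energy_varifold[OF M k, of \<beta> \<gamma> H] m mass by (simp add: C_def)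
qed

end

section \<open>Separation of the multiplicities\<close>

lemma borel_measurable_phase_dist_powr:
  "(\<lambda>zw. ennreal (phase_dist (fst zw) (snd zw) powr p)) \<in> borel_measurable borel"
proof -
  have "(\<lambda>zw. phase_dist (fst zw) (snd zw)) \<in> borel_measurable borel"
    unfolding phase_dist_def by (intro borel_measurable_continuous_onI continuous_intros)
  then show ?thesis by measurable
qed

lemma transport_cost_commute: "transport_cost p V W = transport_cost p W V"
proof -
  have le: "transport_cost p V W \<le> transport_cost p W V" for V W
    unfolding transport_cost_def[of p W V]
  proof (rule INF_greatest)
    fix \<Lambda> assume \<Lambda>: "\<Lambda> \<in> couplings W V"
    let ?swap = "\<lambda>z :: (R3 \<times> R3) \<times> (R3 \<times> R3). (snd z, fst z)"
    have sets: "sets \<Lambda> = sets borel" using \<Lambda> by (simp add: couplings_def)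
    have swap: "?swap \<in> measurable \<Lambda> borel"
      unfolding measurable_cong_sets[OF sets refl]
      by (intro borel_measurable_continuous_onI continuous_intros)
    have fst_snd: "fst \<in> borel_measurable (borel :: ((R3 \<times> R3) \<times> (R3 \<times> R3)) measure)"
        "snd \<in> borel_measurable (borel :: ((R3 \<times> R3) \<times> (R3 \<times> R3)) measure)"
      by (intro borel_measurable_continuous_onI continuous_intros)+
    have "distr (distr \<Lambda> borel ?swap) borel fst = V" "distr (distr \<Lambda> borel ?swap) borel snd = W"
      using \<Lambda> by (simp_all add: distr_distr[OF _ swap] fst_snd comp_def couplings_def)
    then have "distr \<Lambda> borel ?swap \<in> couplings V W" by (simp add: couplings_def)
    then have "transport_cost p V W
        \<le> (\<integral>\<^sup>+ zw. ennreal (phase_dist (fst zw) (snd zw) powr p) \<partial>distr \<Lambda> borel ?swap)"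
      unfolding transport_cost_def by (rule INF_lower)
    also have "\<dots> = (\<integral>\<^sup>+ zw. ennreal (phase_dist (snd zw) (fst zw) powr p) \<partial>\<Lambda>)"
      by (subst nn_integral_distr[OF swap]) (simp_all add: borel_measurable_phase_dist_powr)
    also have "\<dots> = (\<integral>\<^sup>+ zw. ennreal (phase_dist (fst zw) (snd zw) powr p) \<partial>\<Lambda>)"
      by (simp add: phase_dist_def norm_minus_commute)
    finally show "transport_cost p V W \<le> (\<integral>\<^sup>+ zw. ennreal (phase_dist (fst zw) (snd zw) powr p) \<partial>\<Lambda>)" .
  qed
  show ?thesis by (rule antisym[OF le le])
qed

lemma transport_cost_self:
  assumes V: "sets V = sets borel"
  shows "transport_cost p V V = 0"
proof -
  let ?diag = "\<lambda>z :: R3 \<times> R3. (z, z)"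
  have diag: "?diag \<in> measurable V borel"
    unfolding measurable_cong_sets[OF V refl]
    by (intro borel_measurable_continuous_onI continuous_intros)
  have fst_snd: "fst \<in> borel_measurable (borel :: ((R3 \<times> R3) \<times> (R3 \<times> R3)) measure)"
      "snd \<in> borel_measurable (borel :: ((R3 \<times> R3) \<times> (R3 \<times> R3)) measure)"
    by (intro borel_measurable_continuous_onI continuous_intros)+
  have "distr V borel (\<lambda>z. z) = V" using V[symmetric] by (rule distr_id2)
  then have "distr V borel ?diag \<in> couplings V V"
    by (simp add: couplings_def distr_distr[OF _ diag] fst_snd comp_def)
  then have "transport_cost p V V \<le> (\<integral>\<^sup>+ zw. ennreal (phase_dist (fst zw) (snd zw) powr p) \<partial>distr V borel ?diag)"
    unfolding transport_cost_def by (rule INF_lower)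
  also have "\<dots> = 0"
    by (subst nn_integral_distr[OF diag])
      (simp add: borel_measurable_phase_dist_powr, simp add: phase_dist_def)
  finally show ?thesis by simp
qed

lemma wasserstein_commute: "wasserstein p V W = wasserstein p W V"
  by (simp add: wasserstein_def transport_cost_commute[of p V W])

lemma wasserstein_self: "sets V = sets borel \<Longrightarrow> wasserstein p V V = 0"
  by (simp add: wasserstein_def transport_cost_self)

lemma wasserstein_nonneg: "0 \<le> wasserstein p V W"
  by (simp add: wasserstein_def)

lemma wasserstein_less_imp_transport_cost_less:
  assumes "p \<ge> 1" "c > 0" and W: "wasserstein p V W < ereal (c powr (1 / p))"
  shows "transport_cost p V W < ennreal c"
proof -
  have fin: "transport_cost p V W \<noteq> \<infinity>" using W by (auto simp: wasserstein_def)
  then have less: "enn2real (transport_cost p V W) powr (1 / p) < c powr (1 / p)"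
    using W by (simp add: wasserstein_def)
  have "enn2real (transport_cost p V W) < c"
  proof (rule ccontr)
    assume "\<not> ?thesis"
    then have "c powr (1 / p) \<le> enn2real (transport_cost p V W) powr (1 / p)"
      using assms(1,2) by (intro powr_mono2) auto
    then show False using less by linarith
  qed
  then have "ennreal (enn2real (transport_cost p V W)) < ennreal c"
    by (simp add: ennreal_lessI \<open>c > 0\<close>)
  then show ?thesis using fin by (simp add: less_top)
qed

text \<open>If the point \<open>(y, \<nu>' y)\<close> were farther than \<open>\<delta> (2 + 1 / r)\<close> from the graph of \<open>\<nu>\<close>, then all
  points \<open>(y', \<nu>' y')\<close> with \<open>|y' - y| \<le> \<delta>\<close> would have distance at least \<open>\<delta>\<close> from it, since such a
  step moves the point by at most \<open>\<delta> (1 + 1 / r)\<close>. They carry a mass of at least \<open>\<pi> \<delta>\<^sup>2 / 64\<close>, which every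
  coupling would have to transport over that distance.\<close>

lemma transport_near:
  assumes "ball_surface M \<nu> r" "ball_surface M' \<nu>' r" and p: "p \<ge> 0" and k': "k' \<ge> 1"
    and \<delta>: "0 < \<delta>" "\<delta> \<le> r"
    and cost: "transport_cost p (varifold M \<nu> k) (varifold M' \<nu>' k') < ennreal (\<delta> powr p * (pi / 64 * \<delta>\<^sup>2))"
    and y: "y \<in> M'"
  shows "\<exists>x\<in>M. norm (x - y) \<le> \<delta> * (2 + 1 / r) \<and> norm (\<nu> x - \<nu>' y) \<le> \<delta> * (2 + 1 / r)"
proof (rule ccontr)
  interpret S: ball_surface M \<nu> r by fact
  interpret S': ball_surface M' \<nu>' r by fact
  assume "\<not> ?thesis"
  then have far: "\<delta> * (2 + 1 / r) \<le> norm (x - y) + norm (\<nu> x - \<nu>' y)" if "x \<in> M" for x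
    using that norm_ge_zero[of "x - y"] norm_ge_zero[of "\<nu> x - \<nu>' y"] by (smt (verit))
  define N where "N = M' \<inter> cball y \<delta>"
  define \<Gamma> where "\<Gamma> = (\<lambda>x. (x, \<nu> x)) ` M"
  define \<Gamma>' where "\<Gamma>' = (\<lambda>x. (x, \<nu>' x)) ` N"
  have "compact \<Gamma>"
    unfolding \<Gamma>_def by (intro compact_continuous_image continuous_intros S.continuous_on_normal S.compact)
  then have \<Gamma>: "\<Gamma> \<in> sets borel" by (simp add: compact_imp_closed)
  have "compact N" unfolding N_def using S'.compact by (simp add: compact_Int)
  then have "compact \<Gamma>'"
    unfolding \<Gamma>'_def
    by (intro compact_continuous_image continuous_intros continuous_on_subset[OF S'.continuous_on_normal])
      (auto simp: N_def)
  then have \<Gamma>': "\<Gamma>' \<in> sets borel" by (simp add: compact_imp_closed)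
  have N: "N \<in> sets borel" using \<open>compact N\<close> by (simp add: compact_imp_closed)
  obtain \<Lambda> where \<Lambda>: "\<Lambda> \<in> couplings (varifold M \<nu> k) (varifold M' \<nu>' k')"
    and small: "(\<integral>\<^sup>+ zw. ennreal (phase_dist (fst zw) (snd zw) powr p) \<partial>\<Lambda>) < ennreal (\<delta> powr p * (pi / 64 * \<delta>\<^sup>2))"
    using cost unfolding transport_cost_def INF_less_iff by blast
  have sets: "sets \<Lambda> = sets borel" and marg: "distr \<Lambda> borel fst = varifold M \<nu> k" "distr \<Lambda> borel snd = varifold M' \<nu>' k'"
    using \<Lambda> by (auto simp: couplings_def)
  have space: "space \<Lambda> = UNIV" using sets_eq_imp_space_eq[OF sets] by simp
  have meas: "fst \<in> borel_measurable \<Lambda>" "snd \<in> borel_measurable \<Lambda>"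
    unfolding measurable_cong_sets[OF sets refl]
    by (intro borel_measurable_continuous_onI continuous_intros)+
  have sets1: "fst -` A \<in> sets \<Lambda>" "snd -` A \<in> sets \<Lambda>" if "A \<in> sets borel" for A
    using measurable_sets[OF meas(1) that] measurable_sets[OF meas(2) that] by (simp_all add: space)
  define T where "T = snd -` \<Gamma>' \<inter> fst -` \<Gamma>"
  have T: "T \<in> sets \<Lambda>" unfolding T_def using sets1 \<Gamma> \<Gamma>' by blast
  have "emeasure \<Lambda> (fst -` (- \<Gamma>)) = emeasure (varifold M \<nu> k) (- \<Gamma>)"
    using emeasure_distr[OF meas(1), of "- \<Gamma>"] \<Gamma> by (simp add: marg space)
  also have "\<dots> = of_nat k * emeasure hausdorff2 {x \<in> M. (x, \<nu> x) \<in> - \<Gamma>}"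
    using \<Gamma> by (intro S.emeasure_varifold) auto
  also have "{x \<in> M. (x, \<nu> x) \<in> - \<Gamma>} = {}" by (auto simp: \<Gamma>_def)
  finally have null: "emeasure \<Lambda> (fst -` (- \<Gamma>)) = 0" by simp
  have "ennreal (pi / 64 * \<delta>\<^sup>2) \<le> emeasure hausdorff2 N"
    using S'.area_cball_ge[OF y \<delta>] N by (simp add: emeasure_hausdorff2 N_def)
  also have "\<dots> = 1 * emeasure hausdorff2 N" by simp
  also have "\<dots> \<le> of_nat k' * emeasure hausdorff2 N"
    using k' by (intro mult_right_mono) (metis of_nat_1 of_nat_le_iff, simp)
  also have "N = {x \<in> M'. (x, \<nu>' x) \<in> \<Gamma>'}" by (auto simp: N_def \<Gamma>'_def)
  also have "of_nat k' * emeasure hausdorff2 \<dots> = emeasure (varifold M' \<nu>' k') \<Gamma>'"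
    using \<Gamma>' by (simp add: S'.emeasure_varifold)
  also have "\<dots> = emeasure \<Lambda> (snd -` \<Gamma>')"
    using emeasure_distr[OF meas(2), of \<Gamma>'] \<Gamma>' by (simp add: marg space)
  also have "\<dots> \<le> emeasure \<Lambda> (T \<union> fst -` (- \<Gamma>))"
    by (intro emeasure_mono sets.Un T sets1) (use \<Gamma> in \<open>auto simp: T_def\<close>)
  also have "\<dots> \<le> emeasure \<Lambda> T + emeasure \<Lambda> (fst -` (- \<Gamma>))"
    by (intro emeasure_subadditive T sets1) (use \<Gamma> in auto)
  finally have massT: "ennreal (pi / 64 * \<delta>\<^sup>2) \<le> emeasure \<Lambda> T" by (simp add: null)
  have dist: "\<delta> \<le> phase_dist (fst zw) (snd zw)" if "zw \<in> T" for zw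
  proof -
    have "fst zw \<in> \<Gamma>" "snd zw \<in> \<Gamma>'" using that by (simp_all add: T_def)
    then obtain x y' where x: "x \<in> M" "fst zw = (x, \<nu> x)" and y': "y' \<in> N" "snd zw = (y', \<nu>' y')"
      unfolding \<Gamma>_def \<Gamma>'_def by fast
    have d: "norm (y' - y) \<le> \<delta>" using y' by (simp add: N_def dist_norm norm_minus_commute)
    then have "norm (\<nu>' y' - \<nu>' y) \<le> \<delta> / r"
      using S'.normal_lipschitz[of y' y] y y' S'.r_pos divide_right_mono[OF d, of r] by (simp add: N_def)
    then have "norm (x - y) + norm (\<nu> x - \<nu>' y) \<le> (norm (x - y') + \<delta>) + (norm (\<nu> x - \<nu>' y') + \<delta> / r)"
      using d norm_triangle_ineq[of "x - y'" "y' - y"] norm_triangle_ineq[of "\<nu> x - \<nu>' y'" "\<nu>' y' - \<nu>' y"]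
      by simp
    then show ?thesis using far[OF x(1)] by (simp add: phase_dist_def x y' distrib_left)
  qed
  have "ennreal (\<delta> powr p * (pi / 64 * \<delta>\<^sup>2)) = ennreal (\<delta> powr p) * ennreal (pi / 64 * \<delta>\<^sup>2)"
    by (rule ennreal_mult) auto
  also have "\<dots> \<le> ennreal (\<delta> powr p) * emeasure \<Lambda> T"
    by (rule mult_left_mono[OF massT]) simp
  also have "\<dots> = (\<integral>\<^sup>+ zw. ennreal (\<delta> powr p) * indicator T zw \<partial>\<Lambda>)"
    using T by (simp add: nn_integral_cmult_indicator)
  also have "\<dots> \<le> (\<integral>\<^sup>+ zw. ennreal (phase_dist (fst zw) (snd zw) powr p) \<partial>\<Lambda>)"
    using dist p \<delta> by (intro nn_integral_mono) (auto simp: indicator_def intro!: ennreal_leI powr_mono2)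
  finally show False using small by simp
qed

text \<open>The area comparison gives \<open>k \<le> (1 + 4 s)\<^sup>2 k' \<le> k' + 16 s k'\<close>. The lower area bound gives
  \<open>k' \<le> K\<close>, and \<open>s = 1 / (16 (K + 1))\<close> is chosen such that the error is less than one.\<close>

lemma multiplicity_le:
  assumes "ball_surface M \<nu> r" "ball_surface M' \<nu>' r"
    and near: "\<And>y. y \<in> M' \<Longrightarrow> \<exists>x\<in>M. norm (x - y) \<le> \<epsilon> \<and> norm (\<nu> x - \<nu>' y) \<le> \<epsilon>"
    and m: "m > 0" and K: "64 * m / (pi * r\<^sup>2) \<le> K"
    and \<epsilon>: "0 < \<epsilon>" "\<epsilon> * (1 + 2 / r) * (1 + 3 / r) \<le> 1 / (16 * (K + 1))"
    and k: "k' \<ge> 1"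
    and mass: "of_nat k * emeasure hausdorff2 M = ennreal m" "of_nat k' * emeasure hausdorff2 M' = ennreal m"
  shows "k \<le> k'"
proof -
  interpret S: ball_surface M \<nu> r by fact
  interpret S': ball_surface M' \<nu>' r by fact
  define h where "h = measure hausdorff2 M"
  define h' where "h' = measure hausdorff2 M'"
  define s where "s = 1 / (16 * (K + 1))"
  have km: "real k * h = m" "real k' * h' = m"
    using arg_cong[OF mass(1), of enn2real] arg_cong[OF mass(2), of enn2real] m
    by (simp_all add: enn2real_mult measure_def h_def h'_def)
  have k0: "k \<noteq> 0" using km m by (intro notI) simp
  have h: "0 < h" "0 < h'" using km m k0 k by (auto simp: h_def h'_def zero_less_measure_iff)
  have fin: "emeasure hausdorff2 M = ennreal h" "emeasure hausdorff2 M' = ennreal h'"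
    using h unfolding h_def h'_def by (metis emeasure_eq_ennreal_measure enn2real_top less_irrefl measure_def)+
  have "M' \<noteq> {}" using h by (auto simp: h'_def)
  then obtain y where y: "y \<in> M'" by blast
  have K0: "0 \<le> K" using K m S.r_pos by (smt (verit) divide_nonneg_pos mult_pos_pos pi_gt_zero zero_less_power)
  have "ennreal (pi / 64 * r\<^sup>2) \<le> hausdorff2_outer (M' \<inter> cball y r)"
    using S'.area_cball_ge[OF y S.r_pos] by simp
  also have "\<dots> \<le> hausdorff2_outer M'" by (rule hausdorff2_outer_mono) simp
  also have "\<dots> = ennreal h'" using S'.closed fin by (simp add: emeasure_hausdorff2)
  finally have "pi / 64 * r\<^sup>2 \<le> h'" using h by (simp add: ennreal_le_iff)
  then have "real k' * (pi / 64 * r\<^sup>2) \<le> m" unfolding km(2)[symmetric] by (rule mult_left_mono) simp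
  then have "real k' \<le> 64 * m / (pi * r\<^sup>2)"
    using S.r_pos by (simp add: pos_le_divide_eq mult_ac)
  then have k'K: "real k' \<le> K" using K by linarith
  have s: "0 < s" "s \<le> 1 / 16" "16 * s * K < 1"
    using K0 by (simp_all add: s_def field_simps)
  have "hausdorff2_outer M' \<le> ennreal ((1 + 4 * s)\<^sup>2) * hausdorff2_outer M"
    by (rule area_comparison[OF assms(1,2) near \<epsilon>(1)]) (use \<epsilon>(2) s in \<open>simp_all add: s_def\<close>)
  moreover have "hausdorff2_outer M = ennreal h" "hausdorff2_outer M' = ennreal h'"
    using S.closed S'.closed fin by (simp_all add: emeasure_hausdorff2)
  moreover have "ennreal ((1 + 4 * s)\<^sup>2) * ennreal h = ennreal ((1 + 4 * s)\<^sup>2 * h)"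
    using h by (intro ennreal_mult[symmetric]) auto
  ultimately have "ennreal h' \<le> ennreal ((1 + 4 * s)\<^sup>2 * h)" by simp
  then have "h' \<le> (1 + 4 * s)\<^sup>2 * h" using h by (simp add: ennreal_le_iff)
  then have "real k * h \<le> real k' * ((1 + 4 * s)\<^sup>2 * h)"
    using km by (metis mult_left_mono of_nat_0_le_iff)
  then have "real k \<le> real k' * (1 + 4 * s)\<^sup>2" using h by simp
  also have "\<dots> \<le> real k' * (1 + 16 * s)"
  proof (rule mult_left_mono)
    have "s * (16 * s) \<le> s * 8" using s by (intro mult_left_mono) auto
    then show "(1 + 4 * s)\<^sup>2 \<le> 1 + 16 * s" by (simp add: power2_eq_square algebra_simps)
  qed simp
  also have "\<dots> = real k' + 16 * s * real k'" by (simp add: algebra_simps)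
  also have "\<dots> \<le> real k' + 16 * s * K" using k'K s by simp
  also have "\<dots> < real k' + 1" using s by simp
  finally show ?thesis by simp
qed

lemma multiplicity_separation:
  fixes m r p :: real
  assumes m: "m > 0" and r: "r > 0" and p: "p \<ge> 1"
  obtains d where "d > 0"
    "\<And>M \<nu> k M' \<nu>' k'. ball_surface M \<nu> r \<Longrightarrow> ball_surface M' \<nu>' r \<Longrightarrow> k \<ge> 1 \<Longrightarrow> k' \<ge> 1 \<Longrightarrow>
      of_nat k * emeasure hausdorff2 M = ennreal m \<Longrightarrow> of_nat k' * emeasure hausdorff2 M' = ennreal m \<Longrightarrow>
      wasserstein p (varifold M \<nu> k) (varifold M' \<nu>' k') < ereal d \<Longrightarrow> k = k'"
proof -
  define K where "K = 64 * m / (pi * r\<^sup>2)"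
  define \<epsilon> where "\<epsilon> = 1 / (16 * (K + 1)) / ((1 + 2 / r) * (1 + 3 / r))"
  have "0 \<le> K" using m r by (simp add: K_def)
  have pos: "0 < (1 + 2 / r) * (1 + 3 / r)" using r by (intro mult_pos_pos add_pos_pos) auto
  have \<epsilon>: "0 < \<epsilon>" "\<epsilon> * (1 + 2 / r) * (1 + 3 / r) \<le> 1 / (16 * (K + 1))"
    using \<open>0 \<le> K\<close> pos by (simp_all add: \<epsilon>_def mult.assoc)
  define \<delta> where "\<delta> = min r (\<epsilon> / (2 + 1 / r))"
  have pos2: "0 < 2 + 1 / r" using r by (intro add_pos_pos) auto
  have \<delta>: "0 < \<delta>" "\<delta> \<le> r" using r \<epsilon>(1) pos2 by (simp_all add: \<delta>_def)
  have \<delta>\<epsilon>: "\<delta> * (2 + 1 / r) \<le> \<epsilon>"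
    unfolding pos_le_divide_eq[OF pos2, symmetric] by (simp add: \<delta>_def)
  define c where "c = \<delta> powr p * (pi / 64 * \<delta>\<^sup>2)"
  have c: "0 < c" using \<delta> by (simp add: c_def)
  have le: "k \<le> k'"
    if S: "ball_surface M \<nu> r" "ball_surface M' \<nu>' r" and k': "k' \<ge> 1"
      and mass: "of_nat k * emeasure hausdorff2 M = ennreal m" "of_nat k' * emeasure hausdorff2 M' = ennreal m"
      and W: "wasserstein p (varifold M \<nu> k) (varifold M' \<nu>' k') < ereal (c powr (1 / p))"
    for M \<nu> k M' \<nu>' k'
  proof -
    have cost: "transport_cost p (varifold M \<nu> k) (varifold M' \<nu>' k') < ennreal (\<delta> powr p * (pi / 64 * \<delta>\<^sup>2))"
      using wasserstein_less_imp_transport_cost_less[OF p c W] by (simp add: c_def)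
    show ?thesis
    proof (rule multiplicity_le[OF S _ m _ \<epsilon> k' mass])
      fix y assume "y \<in> M'"
      then obtain x where x: "x \<in> M" "norm (x - y) \<le> \<delta> * (2 + 1 / r)" "norm (\<nu> x - \<nu>' y) \<le> \<delta> * (2 + 1 / r)"
        using transport_near[OF S _ k' \<delta> cost] p by auto
      then show "\<exists>x\<in>M. norm (x - y) \<le> \<epsilon> \<and> norm (\<nu> x - \<nu>' y) \<le> \<epsilon>"
        using \<delta>\<epsilon> by (intro bexI[of _ x]) auto
    qed (simp add: K_def)
  qed
  show ?thesis
  proof (rule that[of "c powr (1 / p)"])
    show "k = k'"
      if "ball_surface M \<nu> r" "ball_surface M' \<nu>' r" "k \<ge> 1" "k' \<ge> 1"
        "of_nat k * emeasure hausdorff2 M = ennreal m" "of_nat k' * emeasure hausdorff2 M' = ennreal m"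
        "wasserstein p (varifold M \<nu> k) (varifold M' \<nu>' k') < ereal (c powr (1 / p))"
      for M \<nu> k M' \<nu>' k'
      using le[of M \<nu> M' \<nu>' k' k] le[of M' \<nu>' M \<nu> k k'] that by (simp add: wasserstein_commute)
  qed (use c in simp)
qed

section \<open>Minimizing movements\<close>

text \<open>The predecessor \<open>X n\<close> is a competitor for \<open>X (Suc n)\<close> at zero distance. So the energy decreases
  along the sequence, and the distance is controlled by what is left above the lower bound
  \<open>- B\<close>.\<close>

lemma discrete_minimizers_bounds:
  assumes X: "discrete_minimizers p G A \<tau> V\<^sub>0 X" and \<tau>: "\<tau> > 0" and V\<^sub>0: "V\<^sub>0 \<in> A"
    and borel: "\<And>V. V \<in> A \<Longrightarrow> sets V = sets borel"
    and lower: "\<And>V. V \<in> A \<Longrightarrow> ereal (- B) \<le> G V" and upper: "G V\<^sub>0 \<le> ereal E"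
  shows "X n \<in> A" "(wasserstein p (X (Suc n)) (X n))\<^sup>2 \<le> ereal (2 * \<tau> * (E + B))"
proof -
  have step: "X (Suc n) \<in> A"
      "G (X (Suc n)) + ereal (1 / (2 * \<tau>)) * (wasserstein p (X (Suc n)) (X n))\<^sup>2 \<le> G (X n)" if "X n \<in> A" for n
  proof -
    let ?f = "\<lambda>V. G V + ereal (1 / (2 * \<tau>)) * (wasserstein p V (X n))\<^sup>2"
    have min: "is_arg_min ?f (\<lambda>V. V \<in> A) (X (Suc n))"
      using X by (simp add: discrete_minimizers_def)
    then show "X (Suc n) \<in> A" by (simp add: is_arg_min_def)
    have "?f (X (Suc n)) \<le> ?f (X n)" using min that by (auto simp: is_arg_min_def not_less)
    also have "?f (X n) = G (X n)"
      using wasserstein_self[OF borel[OF that]] by (simp add: power2_eq_square)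
    finally show "?f (X (Suc n)) \<le> G (X n)" .
  qed
  have nonneg: "0 \<le> ereal (1 / (2 * \<tau>)) * (wasserstein p V W)\<^sup>2" for V W
    using \<tau> by (intro ereal_0_le_mult) (auto simp: power2_eq_square wasserstein_nonneg)
  have bound: "X n \<in> A \<and> G (X n) \<le> ereal E" for n
  proof (induction n)
    case 0
    then show ?case using X V\<^sub>0 upper by (simp add: discrete_minimizers_def)
  next
    case (Suc n)
    have "G (X (Suc n)) + 0 \<le> G (X (Suc n)) + ereal (1 / (2 * \<tau>)) * (wasserstein p (X (Suc n)) (X n))\<^sup>2"
      by (rule add_left_mono[OF nonneg])
    also have "\<dots> \<le> G (X n)" using step Suc by blast
    finally show ?case using Suc step(1) by auto
  qed
  then show "X n \<in> A" by blast
  have "ereal (- B) + ereal (1 / (2 * \<tau>)) * (wasserstein p (X (Suc n)) (X n))\<^sup>2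
      \<le> G (X (Suc n)) + ereal (1 / (2 * \<tau>)) * (wasserstein p (X (Suc n)) (X n))\<^sup>2"
    using bound by (intro add_right_mono lower) blast
  also have "\<dots> \<le> ereal E" using step(2)[of n] bound[of n] order_trans by blast
  finally have *: "ereal (- B) + ereal (1 / (2 * \<tau>)) * (wasserstein p (X (Suc n)) (X n))\<^sup>2 \<le> ereal E" .
  show "(wasserstein p (X (Suc n)) (X n))\<^sup>2 \<le> ereal (2 * \<tau> * (E + B))"
  proof (cases "wasserstein p (X (Suc n)) (X n)")
    case (real w)
    then have "- B + 1 / (2 * \<tau>) * w\<^sup>2 \<le> E" using * by simp
    then show ?thesis using real \<tau> by (simp add: field_simps)
  next
    case PInf
    then show ?thesis using * \<tau> by (simp add: power2_eq_square)
  next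
    case MInf
    then show ?thesis using wasserstein_nonneg[of p "X (Suc n)" "X n"] by simp
  qed
qed

lemma admissible_ball_surface:
  assumes "smooth_closed_surface S" "r > 0" "V \<in> admissible S L r m k"
  obtains M \<nu> where "ball_surface M \<nu> r" "C11_closed_surface M"
    "of_nat k * emeasure hausdorff2 M = ennreal m" "V = varifold M \<nu> k"
proof -
  obtain \<psi> \<nu> where \<psi>: "C11_embedding S \<psi>" "outer_unit_normal (\<psi> ` S) \<nu>" "uniform_ball_condition r (\<psi> ` S) \<nu>"
      "of_nat k * emeasure hausdorff2 (\<psi> ` S) = ennreal m" "V = varifold (\<psi> ` S) \<nu> k"
    using assms(3) by (auto simp: admissible_def)
  have "compact (\<psi> ` S)"
    using \<psi>(1) assms(1) by (auto simp: smooth_closed_surface_def C11_embedding_def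
      intro: compact_continuous_image differentiable_imp_continuous_on)
  then have "ball_surface (\<psi> ` S) \<nu> r" using \<psi> assms(2) by unfold_locales
  moreover have "C11_closed_surface (\<psi> ` S)"
    using assms(1) \<psi>(1) by (auto simp: C11_closed_surface_def)
  ultimately show ?thesis using that \<psi> by blast
qed

theorem theorem5p6:
  fixes m\<^sub>0 \<beta> \<gamma> H\<^sub>0 p L r :: real
    and g k :: nat
    and \<Sigma>g :: "R3 set"
    and V\<^sub>0 :: "(R3 \<times> R3) measure"
    and V :: "real \<Rightarrow> (R3 \<times> R3) measure"
  assumes "m\<^sub>0 > 0" and "\<beta> > 0" and "p \<ge> 1" and "L > 0" and "r > 0"
    and "smooth_closed_surface \<Sigma>g" and "has_genus \<Sigma>g g"
    and "- (6 / 5) * \<beta> < \<gamma>" and "\<gamma> < 0"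
    and "k \<ge> 1"
    and "V\<^sub>0 \<in> admissible \<Sigma>g L r m\<^sub>0 k"
    and "CH_energy \<beta> \<gamma> H\<^sub>0 V\<^sub>0 < \<infinity>"
    and "is_GMM p (CH_energy \<beta> \<gamma> H\<^sub>0) (admissible_all \<Sigma>g L r m\<^sub>0) V\<^sub>0 V"
  shows "\<forall>t\<ge>0. V t \<in> admissible \<Sigma>g L r m\<^sub>0 k"
proof -
  let ?A = "admissible_all \<Sigma>g L r m\<^sub>0" and ?Ak = "admissible \<Sigma>g L r m\<^sub>0 k" and ?G = "CH_energy \<beta> \<gamma> H\<^sub>0"
  have surface: "\<exists>M \<nu>. ball_surface M \<nu> r \<and> C11_closed_surface M \<and>
      of_nat j * emeasure hausdorff2 M = ennreal m\<^sub>0 \<and> W = varifold M \<nu> j"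
    if "W \<in> admissible \<Sigma>g L r m\<^sub>0 j" for W j
    using admissible_ball_surface[OF \<open>smooth_closed_surface \<Sigma>g\<close> \<open>r > 0\<close> that] by metis
  obtain d where "d > 0" and d: "\<And>M \<nu> k M' \<nu>' k'. ball_surface M \<nu> r \<Longrightarrow> ball_surface M' \<nu>' r \<Longrightarrow> k \<ge> 1 \<Longrightarrow> k' \<ge> 1 \<Longrightarrow>
      of_nat k * emeasure hausdorff2 M = ennreal m\<^sub>0 \<Longrightarrow> of_nat k' * emeasure hausdorff2 M' = ennreal m\<^sub>0 \<Longrightarrow>
      wasserstein p (varifold M \<nu> k) (varifold M' \<nu>' k') < ereal d \<Longrightarrow> k = k'"
    using multiplicity_separation[OF \<open>m\<^sub>0 > 0\<close> \<open>r > 0\<close> \<open>p \<ge> 1\<close>] by metis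
  have keep: "W' \<in> ?Ak" if W: "W \<in> ?Ak" "W' \<in> ?A" "wasserstein p W W' < ereal d" for W W'
  proof -
    obtain j where j: "j \<ge> 1" "W' \<in> admissible \<Sigma>g L r m\<^sub>0 j"
      using W(2) by (auto simp: admissible_all_def)
    have "k = j"
      using surface[OF W(1)] surface[OF j(2)] d[of _ _ _ _ k j] W(3) j(1) \<open>k \<ge> 1\<close> by blast
    then show ?thesis using j(2) by simp
  qed
  have "?Ak \<subseteq> ?A" using \<open>k \<ge> 1\<close> by (auto simp: admissible_all_def)
  then have V\<^sub>0A: "V\<^sub>0 \<in> ?A" using assms(11) by blast
  \<comment> \<open>the bound on the energy density from \<open>CH_density_bound\<close>, times the total mass\<close>
  define B where "B = m\<^sub>0 * (\<bar>\<beta>\<bar> / 2 * (3 / r + \<bar>H\<^sub>0\<bar>)\<^sup>2 + \<bar>\<gamma>\<bar> * (6 * (1 / r + 1) ^ 3))"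
  have lower: "ereal (- B) \<le> ?G W" if W: "W \<in> ?A" for W
  proof -
    obtain j where j: "j \<ge> 1" "W \<in> admissible \<Sigma>g L r m\<^sub>0 j"
      using W by (auto simp: admissible_all_def)
    obtain M \<nu> where M: "ball_surface M \<nu> r" "C11_closed_surface M"
      "of_nat j * emeasure hausdorff2 M = ennreal m\<^sub>0" "W = varifold M \<nu> j"
      using surface[OF j(2)] by blast
    show ?thesis
      using ball_surface.CH_energy_varifold_ge[OF M(1,2) j(1) \<open>m\<^sub>0 > 0\<close> M(3), of \<beta> H\<^sub>0 \<gamma>] by (simp add: B_def M(4))
  qed
  obtain E where E: "?G V\<^sub>0 = ereal E"
    using lower[OF V\<^sub>0A] assms(12) by (cases "?G V\<^sub>0") auto
  have borel: "sets W = sets borel" if "W \<in> ?A" for W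
    using that by (auto simp: admissible_all_def admissible_def)
  obtain \<tau> X where \<tau>: "\<And>m :: nat. \<tau> m > 0" "\<tau> \<longlonglongrightarrow> 0"
    and X: "\<And>m. discrete_minimizers p ?G ?A (\<tau> m) V\<^sub>0 (X m)"
    and lim: "\<And>t. t \<ge> 0 \<Longrightarrow> (\<lambda>m. wasserstein p (interpolant (\<tau> m) (X m) t) (V t)) \<longlonglongrightarrow> 0"
    and VA: "\<And>t. t \<ge> 0 \<Longrightarrow> V t \<in> ?A"
    using assms(13) unfolding is_GMM_def by blast
  note bounds = discrete_minimizers_bounds[OF X \<tau>(1) V\<^sub>0A borel lower, of E]
  have "(\<lambda>m. 2 * \<tau> m * (E + B)) \<longlonglongrightarrow> 2 * 0 * (E + B)"
    by (intro tendsto_intros \<tau>(2))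
  then have "\<forall>\<^sub>F m in sequentially. 2 * \<tau> m * (E + B) < d\<^sup>2"
    using \<open>d > 0\<close> by (intro order_tendstoD(2)) auto
  then have discrete: "\<forall>\<^sub>F m in sequentially. \<forall>n. X m n \<in> ?Ak"
  proof eventually_elim
    case (elim m)
    show ?case
    proof
      fix n
      show "X m n \<in> ?Ak"
      proof (induction n)
        case 0
        then show ?case using X[of m] assms(11) by (simp add: discrete_minimizers_def)
      next
        case (Suc n)
        have "(wasserstein p (X m (Suc n)) (X m n))\<^sup>2 < ereal (d\<^sup>2)"
          by (rule le_less_trans[OF bounds(2)]) (use E elim in auto)
        then have "wasserstein p (X m (Suc n)) (X m n) < ereal d"
          using \<open>d > 0\<close> wasserstein_nonneg[of p "X m (Suc n)" "X m n"]
          by (cases "wasserstein p (X m (Suc n)) (X m n)") (auto intro: power_less_imp_less_base)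
        then show ?case
          using keep[OF Suc] bounds(1)[of m "Suc n"] E by (simp add: wasserstein_commute)
      qed
    qed
  qed
  show ?thesis
  proof (intro allI impI)
    fix t :: real assume "t \<ge> 0"
    have "\<forall>\<^sub>F m in sequentially. wasserstein p (interpolant (\<tau> m) (X m) t) (V t) < ereal d"
      using lim[OF \<open>t \<ge> 0\<close>] \<open>d > 0\<close> by (intro order_tendstoD(2)) auto
    with discrete have "\<forall>\<^sub>F m in sequentially. V t \<in> ?Ak"
    proof eventually_elim
      case (elim m)
      then show ?case using keep[OF _ VA[OF \<open>t \<ge> 0\<close>]] by (auto simp: interpolant_def)
    qed
    then show "V t \<in> ?Ak" by simp
  qed
qed

end
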